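(* Let $k\in\mathbb{N}$ and let $t_1,\ldots,t_n$ be group terms in $k$ variables. The following are equivalent: (1) $\mathcal{LG} \models e \le t_1 \lor \ldots \lor t_n$; (2) $\{t_1,\ldots,t_n\}$ does not extend to a right order of the free group $\mathbf{F}(k)$; (3) there exist $s_1,\ldots,s_m \in F(k)\setminus\{e\}$ such that $e \in \langle \{t_1,\ldots,t_n,s_1^{\delta_1},\ldots,s_m^{\delta_m}\}\rangle$ for all $\delta_1,\ldots,\delta_m \in \{-1,1\}$.
   Context: An $\ell$-group is an algebra $\langle L,\land,\lor,\cdot,{}^{-1},e\rangle$ such that $\langle L,\cdot,{}^{-1},e\rangle$ is a group, $\langle L,\land,\lor\rangle$ is a lattice, and $a\le b$ implies $cad\le cbd$. $\mathcal{LG}$ is the variety of all $\ell$-groups; $\mathcal{LG}\models e\le t_1\lor\dots\lor t_n$ means the inequation holds in every $\ell$-group under every assignment. $\mathbf{F}(k)$ is the free group on $k$ generators, and group terms are identified with their images in it. For $S\subseteq F(k)$, $\langle S\rangle$ is the subsemigroup generated by $S$. A partial right order of a group $\mathbf{G}$ is a partial order $\le$ on $G$ with $a\le b \Rightarrow ac\le bc$; it is a right order if every element $a$ satisfies $e<a$, $a<e$ or $a=e$. A subset $S$ extends to a right order if there is a right order $\le$ with $e<s$ for all $s\in S$. *)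

theory Defs
  imports
    "HOL-Algebra.Group"
    "HOL-Library.Infinite_Typeclass"
    "HOL-Library.Countable_Set"
begin

section \<open>Group terms\<close>

datatype gterm = GVar nat | GOne | GMult gterm gterm | GInv gterm

primrec gvars :: "gterm \<Rightarrow> nat set" where
  "gvars (GVar i) = {i}"
| "gvars GOne = {}"
| "gvars (GMult s t) = gvars s \<union> gvars t"
| "gvars (GInv t) = gvars t"

primrec geval :: "('a, 'm) monoid_scheme \<Rightarrow> (nat \<Rightarrow> 'a) \<Rightarrow> gterm \<Rightarrow> 'a" where
  "geval G \<phi> (GVar i) = \<phi> i"
| "geval G \<phi> GOne = \<one>\<^bsub>G\<^esub>"
| "geval G \<phi> (GMult s t) = geval G \<phi> s \<otimes>\<^bsub>G\<^esub> geval G \<phi> t"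
| "geval G \<phi> (GInv t) = inv\<^bsub>G\<^esub> (geval G \<phi> t)"


section \<open>Lattice-ordered groups\<close>

record 'a lgroup = "'a monoid" +
  lmeet :: "'a \<Rightarrow> 'a \<Rightarrow> 'a"
  ljoin :: "'a \<Rightarrow> 'a \<Rightarrow> 'a"

definition lg_le :: "('a, 'm) lgroup_scheme \<Rightarrow> 'a \<Rightarrow> 'a \<Rightarrow> bool" where
  "lg_le L a b \<longleftrightarrow> lmeet L a b = a"

locale l_group = group L for L :: "('a, 'm) lgroup_scheme" (structure) +
  assumes lmeet_closed: "\<lbrakk>a \<in> carrier L; b \<in> carrier L\<rbrakk> \<Longrightarrow> lmeet L a b \<in> carrier L"
    and ljoin_closed: "\<lbrakk>a \<in> carrier L; b \<in> carrier L\<rbrakk> \<Longrightarrow> ljoin L a b \<in> carrier L"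
    and lmeet_comm: "\<lbrakk>a \<in> carrier L; b \<in> carrier L\<rbrakk> \<Longrightarrow> lmeet L a b = lmeet L b a"
    and ljoin_comm: "\<lbrakk>a \<in> carrier L; b \<in> carrier L\<rbrakk> \<Longrightarrow> ljoin L a b = ljoin L b a"
    and lmeet_assoc: "\<lbrakk>a \<in> carrier L; b \<in> carrier L; c \<in> carrier L\<rbrakk>
          \<Longrightarrow> lmeet L (lmeet L a b) c = lmeet L a (lmeet L b c)"
    and ljoin_assoc: "\<lbrakk>a \<in> carrier L; b \<in> carrier L; c \<in> carrier L\<rbrakk>
          \<Longrightarrow> ljoin L (ljoin L a b) c = ljoin L a (ljoin L b c)"
    and lmeet_absorb: "\<lbrakk>a \<in> carrier L; b \<in> carrier L\<rbrakk> \<Longrightarrow> lmeet L a (ljoin L a b) = a"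
    and ljoin_absorb: "\<lbrakk>a \<in> carrier L; b \<in> carrier L\<rbrakk> \<Longrightarrow> ljoin L a (lmeet L a b) = a"
    and lg_le_mult: "\<lbrakk>a \<in> carrier L; b \<in> carrier L; c \<in> carrier L; d \<in> carrier L; lg_le L a b\<rbrakk>
          \<Longrightarrow> lg_le L (c \<otimes> a \<otimes> d) (c \<otimes> b \<otimes> d)"

text \<open>The join of a nonempty list; the empty join is left unspecified.\<close>

fun lg_Join :: "('a, 'm) lgroup_scheme \<Rightarrow> 'a list \<Rightarrow> 'a" where
  "lg_Join L [] = undefined"
| "lg_Join L [x] = x"
| "lg_Join L (x # y # ys) = ljoin L x (lg_Join L (y # ys))"

text \<open>
  Validity of \<open>e \<le> t\<^sub>1 \<or> \<dots> \<or> t\<^sub>n\<close> in every \<open>\<ell>\<close>-group.  HOL cannot quantify over types inside a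
  formula, so the type \<open>'a\<close> from which the carriers (arbitrary subsets of \<open>'a\<close>) are drawn is a
  parameter.  By \<open>LG_models_any_type\<close> below, the choice is immaterial as long as \<open>'a\<close> is infinite:
  validity over one infinite type implies validity over every type.
\<close>

definition LG_models :: "'a itself \<Rightarrow> nat \<Rightarrow> gterm list \<Rightarrow> bool" where
  "LG_models (_ :: 'a itself) k ts \<longleftrightarrow>
     (\<forall>L :: 'a lgroup. l_group L \<longrightarrow>
        (\<forall>\<phi> \<in> {..<k} \<rightarrow> carrier L. lg_le L \<one>\<^bsub>L\<^esub> (lg_Join L (map (geval L \<phi>) ts))))"


section \<open>The free group on \<open>k\<close> generators\<close>

text \<open>
  Elements are reduced words; the letter \<open>(i, True)\<close> stands for the \<open>i\<close>-th generator and
  \<open>(i, False)\<close> for its inverse.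
\<close>

type_synonym letter = "nat \<times> bool"

definition inv_letter :: "letter \<Rightarrow> letter" where
  "inv_letter a = (fst a, \<not> snd a)"

definition reduced :: "letter list \<Rightarrow> bool" where
  "reduced w \<longleftrightarrow> successively (\<lambda>a b. b \<noteq> inv_letter a) w"

fun push :: "letter \<Rightarrow> letter list \<Rightarrow> letter list" where
  "push a [] = [a]"
| "push a (b # w) = (if b = inv_letter a then w else a # b # w)"

definition free_group :: "nat \<Rightarrow> letter list monoid" where
  "free_group k =
     \<lparr>carrier = {w. reduced w \<and> fst ` set w \<subseteq> {..<k}}, mult = foldr push, one = []\<rparr>"

definition free_gen :: "nat \<Rightarrow> letter list" where
  "free_gen i = [(i, True)]"

definition free_image :: "nat \<Rightarrow> gterm \<Rightarrow> letter list" where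
  "free_image k t = geval (free_group k) free_gen t"


section \<open>Right orders and generated subsemigroups\<close>

definition partial_right_order :: "('a, 'm) monoid_scheme \<Rightarrow> 'a rel \<Rightarrow> bool" where
  "partial_right_order G r \<longleftrightarrow> partial_order_on (carrier G) r \<and>
     (\<forall>a\<in>carrier G. \<forall>b\<in>carrier G. \<forall>c\<in>carrier G.
        (a, b) \<in> r \<longrightarrow> (a \<otimes>\<^bsub>G\<^esub> c, b \<otimes>\<^bsub>G\<^esub> c) \<in> r)"

definition strict :: "'a rel \<Rightarrow> 'a \<Rightarrow> 'a \<Rightarrow> bool" where
  "strict r a b \<longleftrightarrow> (a, b) \<in> r \<and> a \<noteq> b"

definition right_order :: "('a, 'm) monoid_scheme \<Rightarrow> 'a rel \<Rightarrow> bool" where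
  "right_order G r \<longleftrightarrow> partial_right_order G r \<and>
     (\<forall>a\<in>carrier G. strict r \<one>\<^bsub>G\<^esub> a \<or> strict r a \<one>\<^bsub>G\<^esub> \<or> a = \<one>\<^bsub>G\<^esub>)"

definition extends_to_right_order :: "('a, 'm) monoid_scheme \<Rightarrow> 'a set \<Rightarrow> bool" where
  "extends_to_right_order G S \<longleftrightarrow> (\<exists>r. right_order G r \<and> (\<forall>s\<in>S. strict r \<one>\<^bsub>G\<^esub> s))"

inductive_set subsemigroup :: "('a, 'm) monoid_scheme \<Rightarrow> 'a set \<Rightarrow> 'a set"
  for G :: "('a, 'm) monoid_scheme" and S :: "'a set" where
  incl: "s \<in> S \<Longrightarrow> s \<in> subsemigroup G S"
| mult: "\<lbrakk>a \<in> subsemigroup G S; b \<in> subsemigroup G S\<rbrakk> \<Longrightarrow> a \<otimes>\<^bsub>G\<^esub> b \<in> subsemigroup G S"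


section \<open>The reduced-word construction is the free group\<close>

lemma inv_letter_inv_letter [simp]: "inv_letter (inv_letter a) = a"
  by (simp add: inv_letter_def)

lemma inv_letter_neq [simp]: "inv_letter a \<noteq> a" "a \<noteq> inv_letter a"
  by (cases a; simp add: inv_letter_def)+

lemma reduced_Nil [simp]: "reduced []"
  by (simp add: reduced_def)

lemma reduced_Cons: "reduced (a # w) \<longleftrightarrow> w = [] \<or> hd w \<noteq> inv_letter a \<and> reduced w"
  by (auto simp: reduced_def successively_Cons)

lemma reduced_push: "reduced w \<Longrightarrow> reduced (push a w)"
  by (cases w) (auto simp: reduced_Cons)

lemma push_inv_push: "reduced w \<Longrightarrow> push (inv_letter a) (push a w) = w"
  by (cases w rule: remdups_adj.cases) (auto simp: reduced_Cons)

lemma push_push_inv: "reduced w \<Longrightarrow> push a (push (inv_letter a) w) = w"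
  using push_inv_push[of w "inv_letter a"] by simp

lemma reduced_foldr_push: "reduced w \<Longrightarrow> reduced (foldr push v w)"
  by (induction v) (auto intro: reduced_push)

lemma foldr_push_push:
  assumes "reduced w"
  shows "foldr push (push a v) w = push a (foldr push v w)"
proof (cases v)
  case (Cons b u)
  then show ?thesis
    using push_push_inv[of "foldr push u w" a] reduced_foldr_push[OF assms] by auto
qed simp

lemma foldr_push_assoc:
  "reduced w \<Longrightarrow> foldr push (foldr push u v) w = foldr push u (foldr push v w)"
  by (induction u) (auto simp: foldr_push_push)

lemma foldr_push_Nil: "reduced w \<Longrightarrow> foldr push w [] = w"
proof (induction w)
  case (Cons a w)
  then show ?case by (cases w) (auto simp: reduced_Cons)
qed simp

lemma foldr_push_inverse:
  "reduced w \<Longrightarrow> foldr push (rev (map inv_letter v)) (foldr push v w) = w"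
  by (induction v) (auto simp: push_inv_push reduced_foldr_push)

lemma set_push: "set (push a w) \<subseteq> insert a (set w)"
  by (cases w) auto

lemma set_foldr_push: "set (foldr push v w) \<subseteq> set v \<union> set w"
proof (induction v)
  case (Cons a v)
  then show ?case using set_push[of a "foldr push v w"] by auto
qed simp

lemma group_free_group: "group (free_group k)"
proof (rule groupI)
  fix x y assume "x \<in> carrier (free_group k)" "y \<in> carrier (free_group k)"
  then show "x \<otimes>\<^bsub>free_group k\<^esub> y \<in> carrier (free_group k)"
    using set_foldr_push[of x y] by (fastforce simp: free_group_def reduced_foldr_push)
next
  fix x assume x: "x \<in> carrier (free_group k)"
  define y where "y = foldr push (rev (map inv_letter x)) []"
  have "set y \<subseteq> inv_letter ` set x"
    using set_foldr_push[of "rev (map inv_letter x)" "[]"] by (auto simp: y_def)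
  then have "fst ` set y \<subseteq> fst ` set x"
    by (force simp: inv_letter_def)
  then have "y \<in> carrier (free_group k)"
    using x by (auto simp: free_group_def y_def reduced_foldr_push)
  moreover have "foldr push y x = []"
  proof -
    have "foldr push y x = foldr push (rev (map inv_letter x)) (foldr push x [])"
      using x foldr_push_assoc[of x "rev (map inv_letter x)" "[]"]
      by (auto simp: free_group_def y_def foldr_push_Nil)
    then show ?thesis by (simp add: foldr_push_inverse)
  qed
  ultimately show "\<exists>y\<in>carrier (free_group k). y \<otimes>\<^bsub>free_group k\<^esub> x = \<one>\<^bsub>free_group k\<^esub>"
    by (auto simp: free_group_def)
qed (auto simp: free_group_def foldr_push_assoc)

lemma free_gen_closed: "i < k \<Longrightarrow> free_gen i \<in> carrier (free_group k)"
  by (simp add: free_gen_def free_group_def reduced_Cons)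

definition letter_val :: "('a, 'm) monoid_scheme \<Rightarrow> (nat \<Rightarrow> 'a) \<Rightarrow> letter \<Rightarrow> 'a" where
  "letter_val G \<phi> a = (if snd a then \<phi> (fst a) else inv\<^bsub>G\<^esub> \<phi> (fst a))"

definition word_val :: "('a, 'm) monoid_scheme \<Rightarrow> (nat \<Rightarrow> 'a) \<Rightarrow> letter list \<Rightarrow> 'a" where
  "word_val G \<phi> w = foldr (\<lambda>a x. letter_val G \<phi> a \<otimes>\<^bsub>G\<^esub> x) w \<one>\<^bsub>G\<^esub>"

theorem free_group_universal:
  assumes G: "group G" and \<phi>: "\<phi> \<in> {..<k} \<rightarrow> carrier G"
  shows "\<exists>h \<in> hom (free_group k) G. (\<forall>i<k. h (free_gen i) = \<phi> i) \<and>
    (\<forall>h' \<in> hom (free_group k) G. (\<forall>i<k. h' (free_gen i) = \<phi> i) \<longrightarrow>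
       (\<forall>w \<in> carrier (free_group k). h' w = h w))"
proof -
  interpret G: group G by fact
  interpret F: group "free_group k" by (rule group_free_group)
  let ?h = "word_val G \<phi>"
  have Cons: "?h (a # w) = letter_val G \<phi> a \<otimes>\<^bsub>G\<^esub> ?h w" for a w
    by (simp add: word_val_def)
  have lv: "letter_val G \<phi> a \<in> carrier G" if "fst a < k" for a
    using that \<phi> by (auto simp: letter_val_def)
  have lvi: "letter_val G \<phi> (inv_letter a) = inv\<^bsub>G\<^esub> letter_val G \<phi> a" if "fst a < k" for a
    using that G.inv_inv[OF Pi_mem[OF \<phi>], of "fst a"]
    by (auto simp: letter_val_def inv_letter_def)
  have cl: "?h w \<in> carrier G" if "fst ` set w \<subseteq> {..<k}" for w
    using that by (induction w) (auto simp: word_val_def lv)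
  have pu: "?h (push a w) = letter_val G \<phi> a \<otimes>\<^bsub>G\<^esub> ?h w"
    if "fst a < k" "fst ` set w \<subseteq> {..<k}" for a w
  proof (cases w)
    case (Cons b u)
    then show ?thesis using that lv[of a] cl[of u]
      by (auto simp: \<open>\<And>a w. ?h (a # w) = _\<close> lvi G.m_assoc[symmetric])
  qed (simp add: Cons)
  have fo: "?h (foldr push v w) = ?h v \<otimes>\<^bsub>G\<^esub> ?h w"
    if "fst ` set v \<subseteq> {..<k}" "fst ` set w \<subseteq> {..<k}" for v w
    using that
  proof (induction v)
    case Nil
    then show ?case using cl[of w] by (simp add: word_val_def)
  next
    case (Cons a v)
    then have "fst ` set (foldr push v w) \<subseteq> {..<k}"
      using set_foldr_push[of v w] by fastforce
    then show ?case
      using Cons pu[of a "foldr push v w"] cl[of v] cl[of w] lv[of a]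
      by (simp add: \<open>\<And>a w. ?h (a # w) = _\<close> G.m_assoc)
  qed
  have hom: "?h \<in> hom (free_group k) G"
    by (auto simp: hom_def free_group_def intro!: cl fo)
  have gen: "?h (free_gen i) = \<phi> i" if "i < k" for i
    using that Pi_mem[OF \<phi>, of i] by (auto simp: word_val_def letter_val_def free_gen_def)
  have uniq: "h' w = ?h w"
    if h': "h' \<in> hom (free_group k) G" and g: "\<forall>i<k. h' (free_gen i) = \<phi> i"
      and w: "w \<in> carrier (free_group k)" for h' w
    using w
  proof (induction w)
    case Nil
    have "h' \<one>\<^bsub>free_group k\<^esub> = \<one>\<^bsub>G\<^esub>"
      using h' by (rule hom_one) (rule group_free_group, rule G)
    then show ?case by (simp add: free_group_def word_val_def)
  next
    case (Cons a w)
    obtain i b where a: "a = (i, b)" by (cases a)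
    have i: "i < k" and w: "w \<in> carrier (free_group k)"
      and aw: "a # w = push a w" and ac: "[a] \<in> carrier (free_group k)"
      using Cons.prems a by (cases w; auto simp: free_group_def reduced_Cons)+
    have "[a] \<otimes>\<^bsub>free_group k\<^esub> w = a # w"
      using aw by (simp add: free_group_def)
    then have eq: "h' (a # w) = h' [a] \<otimes>\<^bsub>G\<^esub> h' w"
      using hom_mult[OF h' ac w] by simp
    have "h' [a] = letter_val G \<phi> a"
    proof (cases b)
      case True
      then show ?thesis using g i a by (simp add: letter_val_def free_gen_def)
    next
      case False
      interpret gh: group_hom "free_group k" G h'
        by (simp add: group_hom_def group_hom_axioms_def h' G group_free_group)
      have "[a] \<otimes>\<^bsub>free_group k\<^esub> free_gen i = \<one>\<^bsub>free_group k\<^esub>"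
        using False a by (simp add: free_group_def free_gen_def inv_letter_def)
      then have "[a] = inv\<^bsub>free_group k\<^esub> free_gen i"
        using F.inv_equality ac free_gen_closed[OF i] by metis
      then show ?thesis
        using False a g i free_gen_closed[OF i] by (simp add: letter_val_def)
    qed
    then show ?case using eq Cons.IH[OF w] by (simp add: \<open>\<And>a w. ?h (a # w) = _\<close>)
  qed
  show ?thesis using hom gen uniq by blast
qed


section \<open>Independence of the carrier type\<close>

text \<open>
  The subalgebra generated by the values of \<open>k\<close> variables is the set of values of \<open>\<ell>\<close>-group terms,
  hence countable, and can be copied into any infinite type.
\<close>

datatype lterm = LVar nat | LOne | LMult lterm lterm | LInv lterm
  | LMeet lterm lterm | LJoin lterm lterm

instance lterm :: countable
  by countable_datatype

primrec leval :: "('a, 'm) lgroup_scheme \<Rightarrow> (nat \<Rightarrow> 'a) \<Rightarrow> lterm \<Rightarrow> 'a" where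
  "leval L \<phi> (LVar i) = \<phi> i"
| "leval L \<phi> LOne = \<one>\<^bsub>L\<^esub>"
| "leval L \<phi> (LMult s t) = leval L \<phi> s \<otimes>\<^bsub>L\<^esub> leval L \<phi> t"
| "leval L \<phi> (LInv t) = inv\<^bsub>L\<^esub> (leval L \<phi> t)"
| "leval L \<phi> (LMeet s t) = lmeet L (leval L \<phi> s) (leval L \<phi> t)"
| "leval L \<phi> (LJoin s t) = ljoin L (leval L \<phi> s) (leval L \<phi> t)"

theorem LG_models_any_type:
  assumes valid: "LG_models TYPE('a::infinite) k ts"
    and ne: "ts \<noteq> []" and vars: "\<forall>t \<in> set ts. gvars t \<subseteq> {..<k}"
  shows "LG_models TYPE('b) k ts"
  unfolding LG_models_def
proof (intro allI impI ballI)
  fix L :: "'b lgroup" and \<phi>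
  assume L: "l_group L" and \<phi>: "\<phi> \<in> {..<k} \<rightarrow> carrier L"
  interpret L: l_group L by fact
  define \<psi> where "\<psi> i = (if i < k then \<phi> i else \<one>\<^bsub>L\<^esub>)" for i
  define H where "H = range (leval L \<psi>)"
  have \<psi>H: "\<psi> i \<in> H" for i
    unfolding H_def by (rule range_eqI[of _ _ "LVar i"]) simp
  have oneH: "\<one>\<^bsub>L\<^esub> \<in> H"
    unfolding H_def by (rule range_eqI[of _ _ LOne]) simp
  have multH: "x \<otimes>\<^bsub>L\<^esub> y \<in> H" if "x \<in> H" "y \<in> H" for x y
    using that unfolding H_def by (auto intro: range_eqI[of _ _ "LMult _ _"])
  have invH: "inv\<^bsub>L\<^esub> x \<in> H" if "x \<in> H" for x
    using that unfolding H_def by (auto intro: range_eqI[of _ _ "LInv _"])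
  have meetH: "lmeet L x y \<in> H" if "x \<in> H" "y \<in> H" for x y
    using that unfolding H_def by (auto intro: range_eqI[of _ _ "LMeet _ _"])
  have joinH: "ljoin L x y \<in> H" if "x \<in> H" "y \<in> H" for x y
    using that unfolding H_def by (auto intro: range_eqI[of _ _ "LJoin _ _"])
  have "leval L \<psi> t \<in> carrier L" for t
    by (induction t) (use \<phi> in \<open>auto simp: \<psi>_def L.lmeet_closed L.ljoin_closed\<close>)
  then have HL: "x \<in> carrier L" if "x \<in> H" for x
    using that by (auto simp: H_def)
  have "countable H" by (simp add: H_def)
  moreover obtain f0 :: "nat \<Rightarrow> 'a" where "inj f0"
    using infinite_countable_subset[OF infinite_UNIV] by blast
  ultimately obtain f :: "'b \<Rightarrow> 'a" where f: "inj_on f H"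
    by (metis comp_inj_on inj_on_subset inj_on_to_nat_on subset_UNIV)
  define g where "g = inv_into H f"
  have gf [simp]: "g (f x) = x" if "x \<in> H" for x
    using that f by (simp add: g_def)
  define M :: "'a lgroup" where "M =
    \<lparr>carrier = f ` H, mult = (\<lambda>x y. f (g x \<otimes>\<^bsub>L\<^esub> g y)), one = f \<one>\<^bsub>L\<^esub>,
     lmeet = (\<lambda>x y. f (lmeet L (g x) (g y))), ljoin = (\<lambda>x y. f (ljoin L (g x) (g y)))\<rparr>"
  have Mc: "carrier M = f ` H" and Mo: "\<one>\<^bsub>M\<^esub> = f \<one>\<^bsub>L\<^esub>"
    and Mm: "x \<in> H \<Longrightarrow> y \<in> H \<Longrightarrow> f x \<otimes>\<^bsub>M\<^esub> f y = f (x \<otimes>\<^bsub>L\<^esub> y)"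
    and Mme: "x \<in> H \<Longrightarrow> y \<in> H \<Longrightarrow> lmeet M (f x) (f y) = f (lmeet L x y)"
    and Mj: "x \<in> H \<Longrightarrow> y \<in> H \<Longrightarrow> ljoin M (f x) (f y) = f (ljoin L x y)" for x y
    by (simp_all add: M_def)
  have feq: "f x = f y \<longleftrightarrow> x = y" if "x \<in> H" "y \<in> H" for x y
    using that f by (auto dest: inj_onD)
  have Mle: "lg_le M (f x) (f y) \<longleftrightarrow> lg_le L x y" if "x \<in> H" "y \<in> H" for x y
    using that by (simp add: lg_le_def Mme feq meetH)
  have gM: "group M"
  proof (rule groupI)
    fix x assume "x \<in> carrier M"
    then obtain u where u: "u \<in> H" "x = f u" by (auto simp: Mc)
    then have "f (inv\<^bsub>L\<^esub> u) \<otimes>\<^bsub>M\<^esub> x = \<one>\<^bsub>M\<^esub>"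
      using HL by (simp add: Mm invH Mo)
    then show "\<exists>y\<in>carrier M. y \<otimes>\<^bsub>M\<^esub> x = \<one>\<^bsub>M\<^esub>" using u invH Mc by blast
  qed (auto simp: Mc Mo Mm multH oneH HL L.m_assoc)
  interpret M: group M by fact
  have lgM: "l_group M"
  proof (intro l_group.intro gM l_group_axioms.intro)
    fix a b assume "a \<in> carrier M" "b \<in> carrier M"
    then obtain x y where [simp]: "x \<in> H" "y \<in> H" "a = f x" "b = f y" by (auto simp: Mc)
    note [simp] = Mc Mme Mj meetH joinH HL feq
    show "lmeet M a b \<in> carrier M" "ljoin M a b \<in> carrier M" by auto
    show "lmeet M a b = lmeet M b a" "ljoin M a b = ljoin M b a"
      by (simp_all add: L.lmeet_comm L.ljoin_comm)
    show "lmeet M a (ljoin M a b) = a" "ljoin M a (lmeet M a b) = a"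
      by (simp_all add: L.lmeet_absorb L.ljoin_absorb)
  next
    fix a b c assume "a \<in> carrier M" "b \<in> carrier M" "c \<in> carrier M"
    then obtain x y z where "x \<in> H" "y \<in> H" "z \<in> H" "a = f x" "b = f y" "c = f z"
      by (auto simp: Mc)
    then show "lmeet M (lmeet M a b) c = lmeet M a (lmeet M b c)"
      "ljoin M (ljoin M a b) c = ljoin M a (ljoin M b c)"
      by (simp_all add: Mme Mj meetH joinH HL L.lmeet_assoc L.ljoin_assoc)
  next
    fix a b c d
    assume "a \<in> carrier M" "b \<in> carrier M" "c \<in> carrier M" "d \<in> carrier M" and le: "lg_le M a b"
    then obtain x y z w where "x \<in> H" "y \<in> H" "z \<in> H" "w \<in> H"
        "a = f x" "b = f y" "c = f z" "d = f w"
      by (auto simp: Mc)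
    then show "lg_le M (c \<otimes>\<^bsub>M\<^esub> a \<otimes>\<^bsub>M\<^esub> d) (c \<otimes>\<^bsub>M\<^esub> b \<otimes>\<^bsub>M\<^esub> d)"
      using le L.lg_le_mult[of x y z w] by (simp add: Mm Mle multH HL)
  qed
  have Mi: "inv\<^bsub>M\<^esub> (f x) = f (inv\<^bsub>L\<^esub> x)" if "x \<in> H" for x
    by (rule M.inv_equality) (use that in \<open>auto simp: Mc Mm Mo invH HL\<close>)
  have ev: "geval L \<psi> t \<in> H \<and> geval M (f \<circ> \<psi>) t = f (geval L \<psi> t)" for t
    by (induction t) (auto simp: \<psi>H oneH multH invH Mo Mm Mi)
  have jo: "lg_Join L (map (geval L \<psi>) us) \<in> H \<and>
      lg_Join M (map (geval M (f \<circ> \<psi>)) us) = f (lg_Join L (map (geval L \<psi>) us))"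
    if "us \<noteq> []" for us
    using that by (induction us rule: induct_list012) (auto simp: ev joinH Mj)
  have "f \<circ> \<psi> \<in> {..<k} \<rightarrow> carrier M" using \<psi>H by (auto simp: Mc)
  then have "lg_le M \<one>\<^bsub>M\<^esub> (lg_Join M (map (geval M (f \<circ> \<psi>)) ts))"
    using valid lgM by (auto simp: LG_models_def)
  then have "lg_le L \<one>\<^bsub>L\<^esub> (lg_Join L (map (geval L \<psi>) ts))"
    using jo[OF ne] by (simp add: Mo Mle oneH)
  moreover have "geval L \<psi> t = geval L \<phi> t" if "gvars t \<subseteq> {..<k}" for t
    using that by (induction t) (auto simp: \<psi>_def)
  ultimately show "lg_le L \<one>\<^bsub>L\<^esub> (lg_Join L (map (geval L \<phi>) ts))"
    using vars by (metis (no_types, lifting) map_eq_conv)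
qed

end

theory Submission
  imports Defs "HOL-Algebra.Bij"
begin

text \<open>
  A right order amounts to a positive cone.  If (3) fails for a set, it still fails after adding one
  of \<open>a\<close>, \<open>a\<^sup>-\<^sup>1\<close>, for any \<open>a \<noteq> e\<close>.  Zorn's lemma yields a set that contains one of them for every such
  \<open>a\<close> and for whose finite subsets (3) fails; this set generates a positive cone.

  A right order with all \<open>t\<^sub>i\<close> positive refutes the inequation in the \<open>\<ell>\<close>-group of automorphisms of
  the chain it defines: the right translations by the \<open>t\<^sub>i\<^sup>-\<^sup>1\<close> all move \<open>e\<close> strictly down.

  Conversely, suppose \<open>e \<le> w\<close> fails in an \<open>\<ell>\<close>-group, where \<open>w\<close> is the value of the join.  A convex
  submonoid \<open>Q\<close> of the positive elements that is maximal without containing \<open>w\<^sup>-\<^sup>1 \<or> e\<close> is prime,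
  because its polars \<open>{y. e \<le> y, x \<and> y \<in> Q}\<close> are convex submonoids as well.  Since the positive and
  negative parts of any \<open>a\<close> are disjoint, the elements below \<open>Q\<close> form a submonoid that contains \<open>a\<close>
  or \<open>a\<^sup>-\<^sup>1\<close> for every \<open>a\<close>, but does not contain \<open>w\<^sup>-\<^sup>1\<close>.  Pulled back to the free group, it defines a
  total right preorder in which all \<open>t\<^sub>i\<close> are strictly positive, and some right order of the free
  group breaks the ties.
\<close>

section \<open>Right orders and positive cones\<close>

definition decides_signs :: "('a, 'm) monoid_scheme \<Rightarrow> 'a set \<Rightarrow> 'a set \<Rightarrow> bool" where
  "decides_signs G A E \<longleftrightarrow> E \<subseteq> carrier G \<and> (\<forall>a\<in>A. a \<in> E \<or> inv\<^bsub>G\<^esub> a \<in> E)"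

definition positive_cone :: "('a, 'm) monoid_scheme \<Rightarrow> 'a set \<Rightarrow> bool" where
  "positive_cone G P \<longleftrightarrow> decides_signs G (carrier G - {\<one>\<^bsub>G\<^esub>}) P \<and> \<one>\<^bsub>G\<^esub> \<notin> P \<and>
     (\<forall>x\<in>P. \<forall>y\<in>P. x \<otimes>\<^bsub>G\<^esub> y \<in> P)"

definition cone_order :: "('a, 'm) monoid_scheme \<Rightarrow> 'a set \<Rightarrow> 'a rel" where
  "cone_order G P =
     {(a, b). a \<in> carrier G \<and> b \<in> carrier G \<and> (a = b \<or> b \<otimes>\<^bsub>G\<^esub> inv\<^bsub>G\<^esub> a \<in> P)}"

lemma decides_signs_Un:
  "decides_signs G (A \<union> B) E \<longleftrightarrow> decides_signs G A E \<and> decides_signs G B E"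
  by (auto simp: decides_signs_def)

lemma right_order_partial_order_on: "right_order G r \<Longrightarrow> partial_order_on (carrier G) r"
  by (simp add: right_order_def partial_right_order_def)

lemma right_order_mult_right:
  assumes "right_order G r" "(a, b) \<in> r" "c \<in> carrier G"
  shows "(a \<otimes>\<^bsub>G\<^esub> c, b \<otimes>\<^bsub>G\<^esub> c) \<in> r"
proof -
  have "a \<in> carrier G" "b \<in> carrier G"
    using partial_order_onD(4)[OF right_order_partial_order_on[OF assms(1)]] assms(2) by auto
  then show ?thesis using assms by (simp add: right_order_def partial_right_order_def)
qed

context group
begin

lemma mult_inv_cancel_middle:
  assumes "a \<in> carrier G" "b \<in> carrier G" "c \<in> carrier G"
  shows "(c \<otimes> inv b) \<otimes> (b \<otimes> inv a) = c \<otimes> inv a"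
proof -
  have "inv b \<otimes> (b \<otimes> inv a) = inv a" using assms by (simp add: inv_solve_left')
  then show ?thesis using assms by (simp add: m_assoc)
qed

lemma mult_right_inv_cancel:
  assumes "a \<in> carrier G" "b \<in> carrier G" "c \<in> carrier G"
  shows "(b \<otimes> c) \<otimes> inv (a \<otimes> c) = b \<otimes> inv a"
  using assms mult_inv_cancel_middle[of a "inv c" b] by (simp add: inv_mult_group m_assoc)

lemma right_order_linear_order_on:
  assumes r: "right_order G r"
  shows "linear_order_on (carrier G) r"
proof -
  note order = partial_order_onD[OF right_order_partial_order_on[OF r]]
  have "(a, b) \<in> r \<or> (b, a) \<in> r" if ab: "a \<in> carrier G" "b \<in> carrier G" for a b
  proof -
    have "b \<otimes> inv a \<in> carrier G" using ab by simp
    then have "(\<one>, b \<otimes> inv a) \<in> r \<or> (b \<otimes> inv a, \<one>) \<in> r"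
      using r refl_onD[OF order(1) one_closed] by (metis right_order_def strict_def)
    then have "(\<one> \<otimes> a, (b \<otimes> inv a) \<otimes> a) \<in> r \<or> ((b \<otimes> inv a) \<otimes> a, \<one> \<otimes> a) \<in> r"
      using right_order_mult_right[OF r] ab(1) by blast
    then show ?thesis using ab by (simp add: m_assoc)
  qed
  then show ?thesis
    using right_order_partial_order_on[OF r] by (simp add: linear_order_on_def total_on_def)
qed

lemma positive_cone_right_order:
  assumes r: "right_order G r"
  shows "positive_cone G {x. strict r \<one> x}"
proof -
  note order = partial_order_onD[OF right_order_partial_order_on[OF r]]
  have "strict r \<one> (inv x)" if "x \<in> carrier G" "strict r x \<one>" for x
    using right_order_mult_right[OF r, of x \<one> "inv x"] that
    by (auto simp: strict_def eq_commute[of \<one>])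
  then have "decides_signs G (carrier G - {\<one>}) {x. strict r \<one> x}"
    using r order(4) by (auto simp: decides_signs_def right_order_def strict_def)
  moreover have "strict r \<one> (x \<otimes> y)" if xy: "strict r \<one> x" "strict r \<one> y" for x y
  proof -
    have y: "y \<in> carrier G" "(\<one>, y) \<in> r" using xy order(4) by (auto simp: strict_def)
    then have le: "(y, x \<otimes> y) \<in> r"
      using right_order_mult_right[OF r, of \<one> x y] xy by (simp add: strict_def)
    then have "x \<otimes> y \<noteq> \<one>" using xy y antisymD[OF order(3)] by (metis strict_def)
    then show ?thesis using transD[OF order(2) y(2) le] by (simp add: strict_def)
  qed
  ultimately show ?thesis by (simp add: positive_cone_def strict_def)
qed

lemma strict_cone_order_one:
  "positive_cone G P \<Longrightarrow> strict (cone_order G P) \<one> x \<longleftrightarrow> x \<in> P"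
  by (auto simp: positive_cone_def decides_signs_def strict_def cone_order_def)

lemma right_order_cone_order:
  assumes P: "positive_cone G P"
  shows "right_order G (cone_order G P)"
proof -
  let ?r = "cone_order G P"
  have one: "\<one> \<notin> P" and mult: "\<And>x y. x \<in> P \<Longrightarrow> y \<in> P \<Longrightarrow> x \<otimes> y \<in> P"
    and decides: "decides_signs G (carrier G - {\<one>}) P"
    using P by (auto simp: positive_cone_def)
  have "trans ?r"
  proof (rule transI)
    fix a b c assume "(a, b) \<in> ?r" "(b, c) \<in> ?r"
    then show "(a, c) \<in> ?r"
      using mult[of "c \<otimes> inv b" "b \<otimes> inv a"] mult_inv_cancel_middle[of a b c]
      by (auto simp: cone_order_def)
  qed
  moreover have "antisym ?r"
  proof (rule antisymI)
    fix a b assume "(a, b) \<in> ?r" "(b, a) \<in> ?r"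
    then show "a = b"
      using mult[of "a \<otimes> inv b" "b \<otimes> inv a"] mult_inv_cancel_middle[of a b a] one
      by (auto simp: cone_order_def)
  qed
  moreover have "?r \<subseteq> carrier G \<times> carrier G" "refl_on (carrier G) ?r"
    by (auto simp: cone_order_def refl_on_def)
  moreover have "(a \<otimes> c, b \<otimes> c) \<in> ?r" if "(a, b) \<in> ?r" "c \<in> carrier G" for a b c
    using that mult_right_inv_cancel by (auto simp: cone_order_def)
  moreover have "strict ?r \<one> a \<or> strict ?r a \<one> \<or> a = \<one>" if "a \<in> carrier G" for a
    using that decides by (auto simp: decides_signs_def strict_def cone_order_def)
  ultimately show ?thesis
    by (auto simp: right_order_def partial_right_order_def order_on_defs)
qed

theorem extends_to_right_order_iff_positive_cone:
  "extends_to_right_order G T \<longleftrightarrow> (\<exists>P. positive_cone G P \<and> T \<subseteq> P)"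
proof
  assume "extends_to_right_order G T"
  then show "\<exists>P. positive_cone G P \<and> T \<subseteq> P"
    using positive_cone_right_order by (fastforce simp: extends_to_right_order_def)
next
  assume "\<exists>P. positive_cone G P \<and> T \<subseteq> P"
  then obtain P where P: "positive_cone G P" "T \<subseteq> P" by blast
  then have "\<forall>s\<in>T. strict (cone_order G P) \<one> s" using strict_cone_order_one by blast
  then show "extends_to_right_order G T"
    using right_order_cone_order[OF P(1)] by (auto simp: extends_to_right_order_def)
qed

text \<open>
  The elements \<open>x \<in> N\<close> with \<open>inv x \<notin> N\<close> are the strictly positive ones of a total right preorder,
  whose ties are broken by \<open>P\<close>.
\<close>

lemma positive_cone_refine:
  assumes P: "positive_cone G P" and N: "decides_signs G (carrier G) N"
    and mult: "\<And>x y. x \<in> N \<Longrightarrow> y \<in> N \<Longrightarrow> x \<otimes> y \<in> N"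
  shows "positive_cone G {x \<in> N. inv x \<in> N \<longrightarrow> x \<in> P}"
proof -
  have carrier: "x \<in> carrier G" if "x \<in> N" for x using that N by (auto simp: decides_signs_def)
  have "x \<otimes> y \<in> P" if xy: "x \<in> N" "inv x \<in> N \<longrightarrow> x \<in> P" "y \<in> N" "inv y \<in> N \<longrightarrow> y \<in> P"
    and tie: "inv (x \<otimes> y) \<in> N" for x y
  proof -
    have "inv y = inv (x \<otimes> y) \<otimes> x" "inv x = y \<otimes> inv (x \<otimes> y)"
      using xy carrier by (simp_all add: inv_mult_group m_assoc, simp add: m_assoc[symmetric])
    then have "inv x \<in> N" "inv y \<in> N" using xy tie mult by simp_all
    then show ?thesis using xy P by (simp add: positive_cone_def)
  qed
  moreover have "x \<in> N \<and> (inv x \<in> N \<longrightarrow> x \<in> P) \<or> inv x \<in> N \<and> (x \<in> N \<longrightarrow> inv x \<in> P)"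
    if "x \<in> carrier G" "x \<noteq> \<one>" for x
    using that P N by (auto simp: positive_cone_def decides_signs_def)
  moreover have "inv \<one> \<in> N \<and> \<one> \<notin> P"
    using P N by (auto simp: positive_cone_def decides_signs_def)
  ultimately show ?thesis
    using carrier mult by (auto simp: positive_cone_def decides_signs_def)
qed

end

section \<open>Refuting every choice of signs\<close>

definition sign_refutable :: "('a, 'm) monoid_scheme \<Rightarrow> 'a set \<Rightarrow> bool" where
  "sign_refutable G T \<longleftrightarrow> (\<exists>(m::nat) s. (\<forall>i<m. s i \<in> carrier G - {\<one>\<^bsub>G\<^esub>}) \<and>
     (\<forall>\<delta> :: nat \<Rightarrow> int. (\<forall>i<m. \<delta> i \<in> {-1, 1}) \<longrightarrow>
        \<one>\<^bsub>G\<^esub> \<in> subsemigroup G (T \<union> {s i [^]\<^bsub>G\<^esub> \<delta> i | i. i < m})))"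

lemma subsemigroup_least:
  assumes "S \<subseteq> H" "\<And>x y. x \<in> H \<Longrightarrow> y \<in> H \<Longrightarrow> x \<otimes>\<^bsub>G\<^esub> y \<in> H"
  shows "subsemigroup G S \<subseteq> H"
proof
  fix x assume "x \<in> subsemigroup G S"
  then show "x \<in> H" by induction (use assms in auto)
qed

lemma subsemigroup_mono: "S \<subseteq> T \<Longrightarrow> subsemigroup G S \<subseteq> subsemigroup G T"
  by (rule subsemigroup_least) (auto intro: subsemigroup.intros)

lemma subsemigroup_finite_support:
  "x \<in> subsemigroup G S \<Longrightarrow> \<exists>U\<subseteq>S. finite U \<and> x \<in> subsemigroup G U"
proof (induction rule: subsemigroup.induct)
  case (incl s)
  then show ?case by (intro exI[of _ "{s}"]) (simp add: subsemigroup.incl)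
next
  case (mult a b)
  then obtain U V where "U \<subseteq> S" "finite U" "a \<in> subsemigroup G U"
    "V \<subseteq> S" "finite V" "b \<in> subsemigroup G V"
    by blast
  then show ?case
    using subsemigroup_mono[of U "U \<union> V" G] subsemigroup_mono[of V "U \<union> V" G]
    by (intro exI[of _ "U \<union> V"]) (auto intro: subsemigroup.mult)
qed

lemma (in group) decides_signs_iff_powers:
  assumes "\<And>i. i \<in> I \<Longrightarrow> s i \<in> carrier G" "E \<subseteq> carrier G"
  shows "decides_signs G (s ` I) E \<longleftrightarrow>
    (\<exists>\<delta> :: _ \<Rightarrow> int. \<forall>i\<in>I. \<delta> i \<in> {-1, 1} \<and> s i [^] \<delta> i \<in> E)"
proof -
  have "s i \<in> E \<or> inv (s i) \<in> E \<longleftrightarrow> (\<exists>d\<in>{-1, 1 :: int}. s i [^] d \<in> E)" if "i \<in> I" for i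
    using assms(1)[OF that] by (auto simp: int_pow_neg)
  then have "decides_signs G (s ` I) E \<longleftrightarrow> (\<forall>i\<in>I. \<exists>d\<in>{-1, 1 :: int}. s i [^] d \<in> E)"
    using assms(2) by (simp add: decides_signs_def)
  then show ?thesis by (simp only: Bex_def bchoice_iff)
qed

lemma (in group) sign_refutableI:
  assumes "finite A" "A \<subseteq> carrier G - {\<one>}"
    and refuted: "\<And>E. decides_signs G A E \<Longrightarrow> \<one> \<in> subsemigroup G (T \<union> E)"
  shows "sign_refutable G T"
proof -
  obtain xs where xs: "set xs = A" using finite_list[OF assms(1)] by blast
  have s: "\<forall>i<length xs. xs ! i \<in> carrier G - {\<one>}" using xs assms(2) nth_mem by blast
  have "\<one> \<in> subsemigroup G (T \<union> {xs ! i [^] \<delta> i | i. i < length xs})"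
    if \<delta>: "\<forall>i<length xs. \<delta> i \<in> {-1, 1}" for \<delta> :: "nat \<Rightarrow> int"
  proof (rule refuted)
    let ?E = "{xs ! i [^] \<delta> i | i. i < length xs}"
    have "?E \<subseteq> carrier G" using s by auto
    moreover have "\<forall>i\<in>{..<length xs}. \<delta> i \<in> {-1, 1} \<and> xs ! i [^] \<delta> i \<in> ?E" using \<delta> by auto
    ultimately have "decides_signs G ((!) xs ` {..<length xs}) ?E"
      using s decides_signs_iff_powers[of "{..<length xs}" "(!) xs" ?E] by blast
    then show "decides_signs G A ?E" using xs by (simp add: nth_image lessThan_atLeast0)
  qed
  then show ?thesis
    unfolding sign_refutable_def using s by (intro exI[of _ "length xs"] exI[of _ "(!) xs"]) simp
qed

lemma (in group) sign_refutable_iff_decides_signs: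
  "sign_refutable G T \<longleftrightarrow> (\<exists>A. finite A \<and> A \<subseteq> carrier G - {\<one>} \<and>
     (\<forall>E. decides_signs G A E \<longrightarrow> \<one> \<in> subsemigroup G (T \<union> E)))"
    (is "_ \<longleftrightarrow> (\<exists>A. ?refutes A)")
proof
  assume "sign_refutable G T"
  then obtain m :: nat and s where s: "\<forall>i<m. s i \<in> carrier G - {\<one>}"
    and refuted: "\<And>\<delta> :: nat \<Rightarrow> int. \<forall>i<m. \<delta> i \<in> {-1, 1} \<Longrightarrow>
      \<one> \<in> subsemigroup G (T \<union> {s i [^] \<delta> i | i. i < m})"
    unfolding sign_refutable_def by blast
  have "\<one> \<in> subsemigroup G (T \<union> E)" if "decides_signs G (s ` {..<m}) E" for E
  proof -
    have "\<exists>\<delta> :: nat \<Rightarrow> int. \<forall>i\<in>{..<m}. \<delta> i \<in> {-1, 1} \<and> s i [^] \<delta> i \<in> E"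
      using that s by (subst decides_signs_iff_powers[symmetric]) (auto simp: decides_signs_def)
    then obtain \<delta> :: "nat \<Rightarrow> int" where
      \<delta>: "\<forall>i<m. \<delta> i \<in> {-1, 1}" "\<forall>i<m. s i [^] \<delta> i \<in> E"
      by blast
    then have "T \<union> {s i [^] \<delta> i | i. i < m} \<subseteq> T \<union> E" by auto
    from subsemigroup_mono[OF this] show ?thesis using refuted[OF \<delta>(1)] by blast
  qed
  then have "?refutes (s ` {..<m})" using s by auto
  then show "\<exists>A. ?refutes A" ..
qed (blast intro: sign_refutableI)

context group
begin

lemma sign_refutable_mono:
  assumes "sign_refutable G S" "S \<subseteq> T"
  shows "sign_refutable G T"
proof -
  have "\<one> \<in> subsemigroup G (T \<union> E)" if "\<one> \<in> subsemigroup G (S \<union> E)" for E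
    using that assms(2) subsemigroup_mono[of "S \<union> E" "T \<union> E" G] by blast
  then show ?thesis using assms(1) unfolding sign_refutable_iff_decides_signs by blast
qed

lemma one_in_subsemigroup_imp_sign_refutable:
  assumes "\<one> \<in> subsemigroup G T"
  shows "sign_refutable G T"
proof -
  have "\<one> \<in> subsemigroup G (T \<union> E)" for E
    using assms subsemigroup_mono[of T "T \<union> E" G] by blast
  then show ?thesis unfolding sign_refutable_iff_decides_signs by blast
qed

lemma sign_refutable_insert:
  assumes a: "a \<in> carrier G - {\<one>}"
    and refutable: "sign_refutable G (insert a T)" "sign_refutable G (insert (inv a) T)"
  shows "sign_refutable G T"
proof -
  obtain A B where A: "finite A" "A \<subseteq> carrier G - {\<one>}"
      "\<And>E. decides_signs G A E \<Longrightarrow> \<one> \<in> subsemigroup G (insert a T \<union> E)"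
    and B: "finite B" "B \<subseteq> carrier G - {\<one>}"
      "\<And>E. decides_signs G B E \<Longrightarrow> \<one> \<in> subsemigroup G (insert (inv a) T \<union> E)"
    using refutable unfolding sign_refutable_iff_decides_signs by metis
  have "\<one> \<in> subsemigroup G (T \<union> E)" if "decides_signs G ({a} \<union> A \<union> B) E" for E
  proof -
    have "insert a T \<union> E = T \<union> E \<or> insert (inv a) T \<union> E = T \<union> E"
      using that by (auto simp: decides_signs_def)
    then show ?thesis using that A(3) B(3) unfolding decides_signs_Un by metis
  qed
  then show ?thesis
    unfolding sign_refutable_iff_decides_signs
    using a A B by (intro exI[of _ "{a} \<union> A \<union> B"]) auto
qed

lemma not_sign_refutable_maximal_extension:
  assumes "T \<subseteq> carrier G" "\<not> sign_refutable G T"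
  obtains S where "T \<subseteq> S" "S \<subseteq> carrier G"
    "\<And>U. finite U \<Longrightarrow> U \<subseteq> S \<Longrightarrow> \<not> sign_refutable G U"
    "\<And>b. b \<in> carrier G - S \<Longrightarrow> \<exists>U\<subseteq>S. finite U \<and> sign_refutable G (insert b U)"
proof -
  define \<A> where
    "\<A> = {S. T \<subseteq> S \<and> S \<subseteq> carrier G \<and> (\<forall>U\<subseteq>S. finite U \<longrightarrow> \<not> sign_refutable G U)}"
  have "T \<in> \<A>" using assms sign_refutable_mono by (auto simp: \<A>_def)
  then have "\<A> \<noteq> {}" by blast
  moreover have "\<Union>\<C> \<in> \<A>" if \<C>: "\<C> \<noteq> {}" "subset.chain \<A> \<C>" for \<C>
  proof -
    have "\<C> \<subseteq> \<A>" using \<C>(2) by (simp add: subset_chain_def)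
    moreover have "\<not> sign_refutable G U" if U: "U \<subseteq> \<Union>\<C>" "finite U" for U
    proof -
      obtain S where "S \<in> \<C>" "U \<subseteq> S" using finite_subset_Union_chain[OF U(2,1) \<C>] .
      then show ?thesis using \<open>\<C> \<subseteq> \<A>\<close> U(2) by (auto simp: \<A>_def)
    qed
    moreover have "T \<subseteq> \<Union>\<C>" "\<Union>\<C> \<subseteq> carrier G"
      using \<C>(1) \<open>\<C> \<subseteq> \<A>\<close> unfolding \<A>_def by blast+
    ultimately show ?thesis by (simp add: \<A>_def)
  qed
  ultimately have "\<exists>S\<in>\<A>. \<forall>S'\<in>\<A>. S \<subseteq> S' \<longrightarrow> S' = S" by (rule subset_Zorn_nonempty)
  then obtain S where S: "S \<in> \<A>" and max: "\<And>S'. S' \<in> \<A> \<Longrightarrow> S \<subseteq> S' \<Longrightarrow> S' = S"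
    by blast
  have "\<exists>U\<subseteq>S. finite U \<and> sign_refutable G (insert b U)" if b: "b \<in> carrier G - S" for b
  proof -
    have "insert b S \<notin> \<A>" using max[of "insert b S"] b by blast
    then obtain U where U: "U \<subseteq> insert b S" "finite U" "sign_refutable G U"
      using S b by (auto simp: \<A>_def)
    have "sign_refutable G (insert b (U - {b}))" by (rule sign_refutable_mono[OF U(3)]) auto
    then show ?thesis using U(1,2) by (intro exI[of _ "U - {b}"]) auto
  qed
  then show ?thesis using that[of S] S by (simp add: \<A>_def)
qed

lemma not_sign_refutable_total_extension:
  assumes "T \<subseteq> carrier G" "\<not> sign_refutable G T"
  obtains S where "T \<subseteq> S" "decides_signs G (carrier G - {\<one>}) S"
    "\<And>U. finite U \<Longrightarrow> U \<subseteq> S \<Longrightarrow> \<not> sign_refutable G U"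
proof -
  obtain S where S: "T \<subseteq> S" "S \<subseteq> carrier G"
    "\<And>U. finite U \<Longrightarrow> U \<subseteq> S \<Longrightarrow> \<not> sign_refutable G U"
    and max: "\<And>b. b \<in> carrier G - S \<Longrightarrow> \<exists>U\<subseteq>S. finite U \<and> sign_refutable G (insert b U)"
    using not_sign_refutable_maximal_extension[OF assms] by blast
  have "a \<in> S \<or> inv a \<in> S" if a: "a \<in> carrier G - {\<one>}" for a
  proof (rule ccontr)
    assume "\<not> ?thesis"
    then obtain U V where U: "U \<subseteq> S" "finite U" "sign_refutable G (insert a U)"
      and V: "V \<subseteq> S" "finite V" "sign_refutable G (insert (inv a) V)"
      using max[of a] max[of "inv a"] a by auto
    have "sign_refutable G (U \<union> V)"
    proof (rule sign_refutable_insert[OF a])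
      show "sign_refutable G (insert a (U \<union> V))" by (rule sign_refutable_mono[OF U(3)]) auto
      show "sign_refutable G (insert (inv a) (U \<union> V))"
        by (rule sign_refutable_mono[OF V(3)]) auto
    qed
    then show False using S(3)[of "U \<union> V"] U V by simp
  qed
  then show ?thesis using that[of S] S by (simp add: decides_signs_def)
qed

theorem extends_to_right_order_iff_not_sign_refutable:
  assumes T: "T \<subseteq> carrier G"
  shows "extends_to_right_order G T \<longleftrightarrow> \<not> sign_refutable G T"
proof
  assume "extends_to_right_order G T"
  then obtain P where P: "positive_cone G P" "T \<subseteq> P"
    by (auto simp: extends_to_right_order_iff_positive_cone)
  have "\<one> \<notin> subsemigroup G (T \<union> P)"
    using P subsemigroup_least[of "T \<union> P" P] by (auto simp: positive_cone_def)
  moreover have "decides_signs G A P" if "A \<subseteq> carrier G - {\<one>}" for A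
    using that P by (auto simp: positive_cone_def decides_signs_def)
  ultimately show "\<not> sign_refutable G T" unfolding sign_refutable_iff_decides_signs by blast
next
  assume "\<not> sign_refutable G T"
  then obtain S where S: "T \<subseteq> S" "decides_signs G (carrier G - {\<one>}) S"
    and finite: "\<And>U. finite U \<Longrightarrow> U \<subseteq> S \<Longrightarrow> \<not> sign_refutable G U"
    using not_sign_refutable_total_extension[OF T] by blast
  have "\<one> \<notin> subsemigroup G S"
    using finite subsemigroup_finite_support one_in_subsemigroup_imp_sign_refutable by metis
  moreover have "subsemigroup G S \<subseteq> carrier G"
    using S(2) by (intro subsemigroup_least) (auto simp: decides_signs_def)
  ultimately have "positive_cone G (subsemigroup G S)"
    using S(2) by (auto simp: positive_cone_def decides_signs_def intro: subsemigroup.intros)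
  then show "extends_to_right_order G T"
    using S(1) by (auto simp: extends_to_right_order_iff_positive_cone intro: subsemigroup.incl)
qed

end

section \<open>Prime convex submonoids of lattice-ordered groups\<close>

context l_group
begin

abbreviation le (infix "\<preceq>" 50) where "a \<preceq> b \<equiv> lg_le L a b"
abbreviation meet (infixl "\<triangle>" 70) where "a \<triangle> b \<equiv> lmeet L a b"
abbreviation join (infixl "\<nabla>" 65) where "a \<nabla> b \<equiv> ljoin L a b"

declare lmeet_closed [simp] ljoin_closed [simp]

lemma lg_le_refl [simp]: "a \<in> carrier L \<Longrightarrow> a \<preceq> a"
  unfolding lg_le_def by (metis ljoin_absorb lmeet_absorb lmeet_closed)

lemma lg_le_antisym: "\<lbrakk>a \<in> carrier L; b \<in> carrier L; a \<preceq> b; b \<preceq> a\<rbrakk> \<Longrightarrow> a = b"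
  unfolding lg_le_def by (metis lmeet_comm)

lemma lg_le_trans:
  "\<lbrakk>a \<preceq> b; b \<preceq> c; a \<in> carrier L; b \<in> carrier L; c \<in> carrier L\<rbrakk> \<Longrightarrow> a \<preceq> c"
  unfolding lg_le_def by (metis lmeet_assoc)

lemma lmeet_le1: "\<lbrakk>a \<in> carrier L; b \<in> carrier L\<rbrakk> \<Longrightarrow> a \<triangle> b \<preceq> a"
  using lg_le_refl[of a] unfolding lg_le_def by (metis lmeet_assoc lmeet_comm)

lemma lmeet_le2: "\<lbrakk>a \<in> carrier L; b \<in> carrier L\<rbrakk> \<Longrightarrow> a \<triangle> b \<preceq> b"
  using lmeet_le1[of b a] by (simp add: lmeet_comm)

lemma lmeet_greatest:
  "\<lbrakk>c \<preceq> a; c \<preceq> b; a \<in> carrier L; b \<in> carrier L; c \<in> carrier L\<rbrakk> \<Longrightarrow> c \<preceq> a \<triangle> b"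
  unfolding lg_le_def by (metis lmeet_assoc)

lemma lg_le_iff_ljoin: "\<lbrakk>a \<in> carrier L; b \<in> carrier L\<rbrakk> \<Longrightarrow> a \<preceq> b \<longleftrightarrow> a \<nabla> b = b"
  unfolding lg_le_def by (metis ljoin_absorb ljoin_comm lmeet_absorb lmeet_comm)

lemma ljoin_ge1: "\<lbrakk>a \<in> carrier L; b \<in> carrier L\<rbrakk> \<Longrightarrow> a \<preceq> a \<nabla> b"
  by (simp add: lg_le_def lmeet_absorb)

lemma ljoin_ge2: "\<lbrakk>a \<in> carrier L; b \<in> carrier L\<rbrakk> \<Longrightarrow> b \<preceq> a \<nabla> b"
  using ljoin_ge1[of b a] by (simp add: ljoin_comm)

lemma ljoin_least:
  "\<lbrakk>a \<preceq> c; b \<preceq> c; a \<in> carrier L; b \<in> carrier L; c \<in> carrier L\<rbrakk> \<Longrightarrow> a \<nabla> b \<preceq> c"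
  by (simp add: lg_le_iff_ljoin ljoin_assoc)

lemma lg_Join_closed_upper:
  assumes "set xs \<subseteq> carrier L" "x \<in> set xs"
  shows "lg_Join L xs \<in> carrier L \<and> x \<preceq> lg_Join L xs"
  using assms
proof (induction xs arbitrary: x rule: induct_list012)
  case (3 y z zs)
  let ?J = "lg_Join L (z # zs)"
  have J: "?J \<in> carrier L" and y: "y \<in> carrier L" using 3 by auto
  have "x \<preceq> y \<nabla> ?J"
  proof (cases "x = y")
    case False
    then have "x \<preceq> ?J" "x \<in> carrier L" using 3 by auto
    then show ?thesis using lg_le_trans[OF _ ljoin_ge2] J y by simp
  qed (use J y in \<open>simp add: ljoin_ge1\<close>)
  then show ?case using J y by simp
qed auto

lemma lg_mult_mono:
  "\<lbrakk>a \<preceq> b; c \<preceq> d; a \<in> carrier L; b \<in> carrier L; c \<in> carrier L; d \<in> carrier L\<rbrakk>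
    \<Longrightarrow> a \<otimes> c \<preceq> b \<otimes> d"
  using lg_le_mult[of a b \<one> c] lg_le_mult[of c d b \<one>] lg_le_trans[of "a \<otimes> c" "b \<otimes> c" "b \<otimes> d"]
  by simp

lemma lg_le_mult_iff_left:
  assumes "a \<in> carrier L" "b \<in> carrier L" "c \<in> carrier L"
  shows "a \<preceq> c \<otimes> b \<longleftrightarrow> inv c \<otimes> a \<preceq> b"
  using assms lg_mult_mono[of "inv c" "inv c" a "c \<otimes> b"] lg_mult_mono[of c c "inv c \<otimes> a" b]
  by (auto simp: m_assoc[symmetric])

lemma lg_le_mult_iff_right:
  assumes "a \<in> carrier L" "b \<in> carrier L" "c \<in> carrier L"
  shows "a \<preceq> b \<otimes> c \<longleftrightarrow> a \<otimes> inv c \<preceq> b"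
  using assms lg_mult_mono[of a "b \<otimes> c" "inv c" "inv c"] lg_mult_mono[of "a \<otimes> inv c" b c c]
  by (auto simp: m_assoc)

lemma lg_inv_antimono:
  assumes "a \<preceq> b" "a \<in> carrier L" "b \<in> carrier L"
  shows "inv b \<preceq> inv a"
  using assms lg_le_mult_iff_left[of a \<one> b] lg_le_mult_iff_right[of "inv b" \<one> a]
    lg_le_mult_iff_right[of "inv b" "inv a" \<one>] lg_le_mult_iff_right[of "inv b" \<one> "inv a"]
  by simp

lemma lmeet_mult_le:
  assumes x: "x \<in> carrier L" "\<one> \<preceq> x" and y: "y \<in> carrier L" "\<one> \<preceq> y"
    and z: "z \<in> carrier L" "\<one> \<preceq> z"
  shows "x \<triangle> (y \<otimes> z) \<preceq> (x \<triangle> y) \<otimes> (x \<triangle> z)"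
proof -
  let ?t = "x \<triangle> (y \<otimes> z)" and ?u = "x \<triangle> y"
  have t: "?t \<in> carrier L" "?t \<preceq> x" "?t \<preceq> y \<otimes> z"
    using x y z by (auto intro: lmeet_le1 lmeet_le2)
  have u: "?u \<in> carrier L" "\<one> \<preceq> ?u" using x y by (auto intro: lmeet_greatest)
  have "?t \<preceq> ?u \<otimes> x" using lg_mult_mono[of \<one> ?u ?t x] t u x by simp
  moreover have "?t \<preceq> ?u \<otimes> z"
  proof -
    have "inv z \<preceq> \<one>" using lg_inv_antimono[of \<one> z] z by simp
    then have "?t \<otimes> inv z \<preceq> x" using lg_mult_mono[of ?t x "inv z" \<one>] t x z by simp
    moreover have "?t \<otimes> inv z \<preceq> y" using t y z by (simp add: lg_le_mult_iff_right[symmetric])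
    ultimately show ?thesis using t x y z by (simp add: lg_le_mult_iff_right lmeet_greatest)
  qed
  ultimately have "inv ?u \<otimes> ?t \<preceq> x \<triangle> z"
    using t u x z by (intro lmeet_greatest) (simp_all add: lg_le_mult_iff_left[symmetric])
  then show ?thesis using t u x z by (simp add: lg_le_mult_iff_left)
qed

lemma positive_negative_parts_disjoint:
  assumes a: "a \<in> carrier L"
  shows "(a \<nabla> \<one>) \<triangle> (inv a \<nabla> \<one>) = \<one>"
proof -
  let ?p = "a \<nabla> \<one>" and ?q = "inv a \<nabla> \<one>"
  let ?c = "?p \<triangle> ?q"
  have c: "?c \<in> carrier L" "?c \<preceq> ?p" "?c \<preceq> ?q"
    using a by (auto intro: lmeet_le1 lmeet_le2)
  have q: "?q \<in> carrier L" "inv a \<preceq> ?q" "\<one> \<preceq> ?q" and p: "\<one> \<preceq> ?p"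
    using a by (auto intro: ljoin_ge1 ljoin_ge2)
  have "?p \<preceq> ?q \<otimes> a"
    using lg_mult_mono[of \<one> ?q a a] lg_le_mult_iff_right[of \<one> ?q a] q a
    by (intro ljoin_least) auto
  then have "?c \<preceq> ?q \<otimes> a" using c a by (intro lg_le_trans[of ?c ?p "?q \<otimes> a"]) auto
  then have "?c \<otimes> inv a \<preceq> ?q" using c a by (simp add: lg_le_mult_iff_right)
  then have "inv a \<preceq> inv ?c \<otimes> ?q" using c a by (simp add: lg_le_mult_iff_left)
  moreover have "\<one> \<preceq> inv ?c \<otimes> ?q" using c q by (simp add: lg_le_mult_iff_left)
  ultimately have "?q \<preceq> inv ?c \<otimes> ?q" using c q a by (intro ljoin_least) auto
  then have "?c \<otimes> ?q \<preceq> ?q" using c q by (simp add: lg_le_mult_iff_left)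
  then have "?c \<preceq> \<one>" using c q lg_le_mult_iff_right[of ?c ?q "inv ?q"] by simp
  moreover have "\<one> \<preceq> ?c" using p q a by (intro lmeet_greatest) auto
  ultimately show ?thesis using c by (intro lg_le_antisym) auto
qed

definition positive_convex_submonoid :: "'a set \<Rightarrow> bool" where
  "positive_convex_submonoid Q \<longleftrightarrow> submonoid Q L \<and> (\<forall>q\<in>Q. \<one> \<preceq> q) \<and>
     (\<forall>q\<in>Q. \<forall>x\<in>carrier L. \<one> \<preceq> x \<and> x \<preceq> q \<longrightarrow> x \<in> Q)"

definition polar :: "'a set \<Rightarrow> 'a \<Rightarrow> 'a set" where
  "polar Q x = {y \<in> carrier L. \<one> \<preceq> y \<and> x \<triangle> y \<in> Q}"

lemma positive_convex_submonoidD: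
  assumes "positive_convex_submonoid Q"
  shows "\<one> \<in> Q" and "q \<in> Q \<Longrightarrow> q \<in> carrier L" and "q \<in> Q \<Longrightarrow> \<one> \<preceq> q"
    and "q \<in> Q \<Longrightarrow> q' \<in> Q \<Longrightarrow> q \<otimes> q' \<in> Q"
    and "q \<in> Q \<Longrightarrow> x \<in> carrier L \<Longrightarrow> \<one> \<preceq> x \<Longrightarrow> x \<preceq> q \<Longrightarrow> x \<in> Q"
proof -
  interpret submonoid Q L using assms by (simp add: positive_convex_submonoid_def)
  show "\<one> \<in> Q" "q \<in> Q \<Longrightarrow> q \<in> carrier L" "q \<in> Q \<Longrightarrow> q' \<in> Q \<Longrightarrow> q \<otimes> q' \<in> Q" by auto
  show "q \<in> Q \<Longrightarrow> \<one> \<preceq> q" "q \<in> Q \<Longrightarrow> x \<in> carrier L \<Longrightarrow> \<one> \<preceq> x \<Longrightarrow> x \<preceq> q \<Longrightarrow> x \<in> Q"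
    using assms unfolding positive_convex_submonoid_def by blast+
qed

lemma subset_polar:
  assumes Q: "positive_convex_submonoid Q" and x: "x \<in> carrier L" "\<one> \<preceq> x"
  shows "Q \<subseteq> polar Q x"
proof
  fix q assume q: "q \<in> Q"
  note Q_props = positive_convex_submonoidD[OF Q]
  have "\<one> \<preceq> x \<triangle> q" "x \<triangle> q \<preceq> q"
    using x Q_props(2,3)[OF q] by (auto intro: lmeet_greatest lmeet_le2)
  then show "q \<in> polar Q x" using Q_props(2,3,5)[OF q] x by (simp add: polar_def)
qed

lemma positive_convex_submonoid_polar:
  assumes Q: "positive_convex_submonoid Q" and x: "x \<in> carrier L" "\<one> \<preceq> x"
  shows "positive_convex_submonoid (polar Q x)"
proof -
  note Q_props = positive_convex_submonoidD[OF Q]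
  have below: "y \<in> polar Q x"
    if y: "y \<in> carrier L" "\<one> \<preceq> y" and q: "x \<triangle> y \<preceq> q" "q \<in> Q" for y q
    using Q_props(5)[OF q(2) _ _ q(1)] x y by (simp add: polar_def lmeet_greatest)
  have "y \<otimes> z \<in> polar Q x" if "y \<in> polar Q x" "z \<in> polar Q x" for y z
  proof (rule below)
    show "y \<otimes> z \<in> carrier L" "\<one> \<preceq> y \<otimes> z"
      using that lg_mult_mono[of \<one> y \<one> z] by (auto simp: polar_def)
    show "x \<triangle> (y \<otimes> z) \<preceq> (x \<triangle> y) \<otimes> (x \<triangle> z)"
      using that x by (intro lmeet_mult_le) (auto simp: polar_def)
    show "(x \<triangle> y) \<otimes> (x \<triangle> z) \<in> Q" using that Q_props(4) by (simp add: polar_def)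
  qed
  moreover have "z \<in> polar Q x"
    if y: "y \<in> polar Q x" and z: "z \<in> carrier L" "\<one> \<preceq> z" "z \<preceq> y" for y z
  proof (rule below[OF z(1,2)])
    have "x \<triangle> z \<preceq> y"
      using y z x by (intro lg_le_trans[OF lmeet_le2 z(3)]) (auto simp: polar_def)
    then show "x \<triangle> z \<preceq> x \<triangle> y"
      using y z x by (intro lmeet_greatest lmeet_le1) (auto simp: polar_def)
    show "x \<triangle> y \<in> Q" using y by (simp add: polar_def)
  qed
  moreover have "\<one> \<in> polar Q x" using subset_polar[OF assms] Q_props(1) by blast
  ultimately show ?thesis
    by (auto simp: positive_convex_submonoid_def submonoid_def polar_def)
qed

lemma positive_convex_submonoid_Union:
  assumes "\<C> \<noteq> {}" "\<And>Q. Q \<in> \<C> \<Longrightarrow> positive_convex_submonoid Q"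
    and chain: "\<And>Q R. Q \<in> \<C> \<Longrightarrow> R \<in> \<C> \<Longrightarrow> Q \<subseteq> R \<or> R \<subseteq> Q"
  shows "positive_convex_submonoid (\<Union>\<C>)"
proof -
  note Q_props = positive_convex_submonoidD[OF assms(2)]
  have "x \<otimes> y \<in> \<Union>\<C>" if xy: "x \<in> \<Union>\<C>" "y \<in> \<Union>\<C>" for x y
  proof -
    obtain Q R where "Q \<in> \<C>" "x \<in> Q" "R \<in> \<C>" "y \<in> R" using xy by blast
    then show ?thesis using chain[of Q R] Q_props(4)[of Q x y] Q_props(4)[of R x y] by blast
  qed
  moreover have "\<Union>\<C> \<subseteq> carrier L" "\<one> \<in> \<Union>\<C>" using Q_props(1,2) assms(1) by auto
  moreover have "\<forall>q\<in>\<Union>\<C>. \<one> \<preceq> q" using Q_props(3) by blast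
  moreover have "\<forall>q\<in>\<Union>\<C>. \<forall>x\<in>carrier L. \<one> \<preceq> x \<and> x \<preceq> q \<longrightarrow> x \<in> \<Union>\<C>"
    using Q_props(5) by blast
  ultimately show ?thesis unfolding positive_convex_submonoid_def submonoid_def by simp
qed

lemma maximal_positive_convex_submonoid_avoiding:
  assumes v: "v \<noteq> \<one>"
  obtains Q where "positive_convex_submonoid Q" "v \<notin> Q"
    "\<And>R. positive_convex_submonoid R \<Longrightarrow> Q \<subseteq> R \<Longrightarrow> v \<notin> R \<Longrightarrow> R = Q"
proof -
  define \<Q> where "\<Q> = {Q. positive_convex_submonoid Q \<and> v \<notin> Q}"
  have "positive_convex_submonoid {\<one>}"
    by (auto simp: positive_convex_submonoid_def submonoid_def intro: lg_le_antisym)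
  then have "\<Q> \<noteq> {}" using v by (auto simp: \<Q>_def)
  moreover have "\<Union>\<C> \<in> \<Q>" if \<C>: "\<C> \<noteq> {}" "subset.chain \<Q> \<C>" for \<C>
    using positive_convex_submonoid_Union[OF \<C>(1)] \<C>(2)
    by (auto simp: \<Q>_def subset_chain_def subset_iff)
  ultimately have "\<exists>Q\<in>\<Q>. \<forall>R\<in>\<Q>. Q \<subseteq> R \<longrightarrow> R = Q" by (rule subset_Zorn_nonempty)
  then show ?thesis using that by (auto simp: \<Q>_def)
qed

lemma maximal_positive_convex_submonoid_prime:
  assumes Q: "positive_convex_submonoid Q" and v: "v \<in> carrier L" "\<one> \<preceq> v" "v \<notin> Q"
    and max: "\<And>R. positive_convex_submonoid R \<Longrightarrow> Q \<subseteq> R \<Longrightarrow> v \<notin> R \<Longrightarrow> R = Q"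
    and p: "p \<in> carrier L" "\<one> \<preceq> p" and q: "q \<in> carrier L" "\<one> \<preceq> q" and pq: "p \<triangle> q \<in> Q"
  shows "p \<in> Q \<or> q \<in> Q"
proof (rule disjCI)
  assume "q \<notin> Q"
  moreover have "q \<in> polar Q p" using pq q by (simp add: polar_def)
  ultimately have "v \<in> polar Q p"
    using max[OF positive_convex_submonoid_polar subset_polar] Q p by blast
  then have "p \<in> polar Q v" using p v by (simp add: polar_def lmeet_comm)
  moreover have "v \<notin> polar Q v" using v lg_le_refl[of v] by (simp add: polar_def lg_le_def)
  ultimately show "p \<in> Q"
    using max[OF positive_convex_submonoid_polar subset_polar] Q v by blast
qed

lemma down_closed_total_submonoid_avoiding:
  assumes u: "u \<in> carrier L" "\<not> u \<preceq> \<one>"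
  obtains N where "decides_signs L (carrier L) N" "u \<notin> N"
    "\<And>x y. x \<in> N \<Longrightarrow> y \<in> N \<Longrightarrow> x \<otimes> y \<in> N"
    "\<And>x y. x \<in> carrier L \<Longrightarrow> x \<preceq> y \<Longrightarrow> y \<in> N \<Longrightarrow> x \<in> N"
proof -
  let ?v = "u \<nabla> \<one>"
  have v: "?v \<in> carrier L" "\<one> \<preceq> ?v" "u \<preceq> ?v" using u by (auto intro: ljoin_ge1 ljoin_ge2)
  then have "?v \<noteq> \<one>" using u by auto
  obtain Q where Q: "positive_convex_submonoid Q" "?v \<notin> Q"
    and max: "\<And>R. positive_convex_submonoid R \<Longrightarrow> Q \<subseteq> R \<Longrightarrow> ?v \<notin> R \<Longrightarrow> R = Q"
    using maximal_positive_convex_submonoid_avoiding[OF \<open>?v \<noteq> \<one>\<close>] by blast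
  note Q_props = positive_convex_submonoidD[OF Q(1)]
  define N where "N = {x \<in> carrier L. \<exists>q\<in>Q. x \<preceq> q}"
  have "a \<in> N \<or> inv a \<in> N" if a: "a \<in> carrier L" for a
  proof -
    have "a \<nabla> \<one> \<in> Q \<or> inv a \<nabla> \<one> \<in> Q"
      using a Q_props(1) positive_negative_parts_disjoint[OF a]
      by (intro maximal_positive_convex_submonoid_prime[OF Q(1) v(1,2) Q(2) max])
        (auto intro: ljoin_ge2)
    then show ?thesis using a by (auto simp: N_def intro: ljoin_ge1)
  qed
  then have "decides_signs L (carrier L) N" by (auto simp: decides_signs_def N_def)
  moreover have "u \<notin> N"
  proof
    assume "u \<in> N"
    then obtain q where q: "q \<in> Q" "u \<preceq> q" by (auto simp: N_def)
    then have "?v \<preceq> q" using Q_props(2,3) u by (intro ljoin_least) auto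
    then show False using Q_props(5)[OF q(1)] v Q(2) by blast
  qed
  moreover have "x \<otimes> y \<in> N" if "x \<in> N" "y \<in> N" for x y
    using that Q_props(2,4) unfolding N_def by (blast intro: lg_mult_mono m_closed)
  moreover have "x \<in> N" if "x \<in> carrier L" "x \<preceq> y" "y \<in> N" for x y
    using that Q_props(2) unfolding N_def by (blast intro: lg_le_trans)
  ultimately show ?thesis by (rule that)
qed

end

theorem (in group) extends_to_right_order_if_not_one_le_lg_Join:
  fixes L (structure)
  assumes L: "l_group L" and h: "h \<in> hom G L" and P: "positive_cone G P"
    and us: "us \<noteq> []" "set us \<subseteq> carrier G" and refuted: "\<not> lg_le L \<one>\<^bsub>L\<^esub> (lg_Join L (map h us))"
  shows "extends_to_right_order G (set us)"
proof -
  interpret L: l_group L by fact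
  interpret h: group_hom G L h by unfold_locales (fact h)
  define w where "w = lg_Join L (map h us)"
  have images_closed: "set (map h us) \<subseteq> carrier L" using us(2) by auto
  have upper: "lg_le L (h t) w" if "t \<in> set us" for t
    using that L.lg_Join_closed_upper[OF images_closed] by (simp add: w_def)
  have w: "w \<in> carrier L"
    using L.lg_Join_closed_upper[OF images_closed, of "h (hd us)"] us(1) by (simp add: w_def)
  have "\<not> lg_le L (inv\<^bsub>L\<^esub> w) \<one>\<^bsub>L\<^esub>"
    using refuted L.lg_inv_antimono[of "inv\<^bsub>L\<^esub> w" "\<one>\<^bsub>L\<^esub>"] w by (auto simp: w_def)
  then obtain N where N: "decides_signs L (carrier L) N" "inv\<^bsub>L\<^esub> w \<notin> N"
      "\<And>x y. x \<in> N \<Longrightarrow> y \<in> N \<Longrightarrow> x \<otimes>\<^bsub>L\<^esub> y \<in> N"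
    and down: "\<And>x y. x \<in> carrier L \<Longrightarrow> lg_le L x y \<Longrightarrow> y \<in> N \<Longrightarrow> x \<in> N"
    using L.down_closed_total_submonoid_avoiding w by (metis L.inv_closed)
  define M where "M = {x \<in> carrier G. h x \<in> N}"
  have M: "decides_signs G (carrier G) M"
    using N(1) by (auto simp: decides_signs_def M_def)
  have "positive_cone G {x \<in> M. inv x \<in> M \<longrightarrow> x \<in> P}"
    using N(3) by (intro positive_cone_refine[OF P M]) (auto simp: M_def)
  moreover have "t \<in> M \<and> inv t \<notin> M" if t: "t \<in> set us" for t
  proof -
    have t_closed: "t \<in> carrier G" using us(2) t by blast
    then have "lg_le L (inv\<^bsub>L\<^esub> w) (inv\<^bsub>L\<^esub> h t)"
      using L.lg_inv_antimono[OF upper[OF t]] w by simp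
    then have "inv t \<notin> M" using down[of "inv\<^bsub>L\<^esub> w"] N(2) w t_closed by (auto simp: M_def)
    then show ?thesis using M t_closed by (auto simp: decides_signs_def)
  qed
  ultimately show ?thesis unfolding extends_to_right_order_iff_positive_cone by blast
qed

section \<open>A positive cone of the free group\<close>

text \<open>
  Order the letters linearly.  In the Cayley tree, a reduced word is a path from the identity;
  \<open>path_weight\<close> adds up the signs of its edges and, at every inner vertex, a sign telling whether
  the outgoing direction is above or below the direction back.  A word of length \<open>n > 0\<close> gets a sum
  of \<open>2 n - 1\<close> signs, hence an odd number.  The three paths between three vertices form a tripod
  along which everything cancels except the turns at the centre, where the linear order
  leaves at most \<open>1\<close>.  So \<open>path_weight\<close> is additive up to \<open>1\<close>, and the words of positive weight
  are closed under multiplication.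
\<close>

definition letter_rank :: "letter \<Rightarrow> int" where
  "letter_rank a = 2 * int (fst a) + of_bool (snd a)"

definition turn :: "letter \<Rightarrow> letter \<Rightarrow> int" where
  "turn a b = sgn (letter_rank b - letter_rank a)"

definition letter_sign :: "letter \<Rightarrow> int" where
  "letter_sign a = (if snd a then 1 else -1)"

fun path_weight :: "letter list \<Rightarrow> int" where
  "path_weight [] = 0"
| "path_weight [a] = letter_sign a"
| "path_weight (a # b # w) = letter_sign a + turn (inv_letter a) b + path_weight (b # w)"

definition joint :: "letter list \<Rightarrow> letter list \<Rightarrow> int" where
  "joint v w = (if v = [] \<or> w = [] then 0 else turn (inv_letter (last v)) (hd w))"

abbreviation inv_word :: "letter list \<Rightarrow> letter list" where
  "inv_word w \<equiv> rev (map inv_letter w)"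

lemma letter_rank_eq_iff: "letter_rank a = letter_rank b \<longleftrightarrow> a = b"
  by (cases a; cases b) (auto simp: letter_rank_def of_bool_def split: if_splits; presburger)

lemma letter_sign_inv: "letter_sign (inv_letter a) = - letter_sign a"
  by (simp add: letter_sign_def inv_letter_def)

lemma odd_letter_sign: "odd (letter_sign a)"
  by (simp add: letter_sign_def)

lemma turn_swap: "turn b a = - turn a b"
  by (simp add: turn_def sgn_if)

lemma odd_turn: "a \<noteq> b \<Longrightarrow> odd (turn a b)"
  using letter_rank_eq_iff[of a b] by (auto simp: turn_def sgn_if)

lemma turn_bound: "\<bar>turn a b\<bar> \<le> 1"
  by (simp add: turn_def sgn_if)

lemma turn_cocycle_bound: "\<bar>turn a b + turn b c - turn a c\<bar> \<le> 1"
  by (auto simp: turn_def sgn_if)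

lemma path_weight_append: "path_weight (v @ w) = path_weight v + joint v w + path_weight w"
proof (induction v rule: path_weight.induct)
  case (2 a)
  then show ?case by (cases w) (auto simp: joint_def)
qed (auto simp: joint_def)

lemma path_weight_inv_word: "path_weight (inv_word w) = - path_weight w"
proof (induction w rule: path_weight.induct)
  case (3 a b w)
  have "path_weight (inv_word (a # b # w)) = path_weight (inv_word (b # w))
      + joint (inv_word (b # w)) [inv_letter a] + path_weight [inv_letter a]"
    by (simp add: path_weight_append del: append_assoc)
  then show ?case using 3 turn_swap[of b "inv_letter a"] by (simp add: letter_sign_inv joint_def)
qed (simp_all add: letter_sign_inv)

lemma odd_path_weight: "reduced w \<Longrightarrow> w \<noteq> [] \<Longrightarrow> odd (path_weight w)"
proof (induction w rule: path_weight.induct)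
  case (3 a b w)
  then show ?case using odd_turn[of "inv_letter a" b] odd_letter_sign[of a]
    by (auto simp: reduced_Cons)
qed (simp_all add: odd_letter_sign)

lemma foldr_push_cancellation:
  assumes "reduced v"
  shows "\<exists>x c y. v = x @ c \<and> w = inv_word c @ y \<and> foldr push v w = x @ y"
  using assms
proof (induction v)
  case Nil
  then show ?case by (intro exI[of _ "[]"] exI[of _ w]) simp
next
  case (Cons a v)
  then obtain x c y where IH: "v = x @ c" "w = inv_word c @ y" "foldr push v w = x @ y"
    by (auto simp: reduced_Cons)
  show ?case
  proof (cases "x = [] \<and> y \<noteq> [] \<and> hd y = inv_letter a")
    case True
    then have "w = inv_word (a # c) @ tl y" "foldr push (a # v) w = tl y"
      using IH by (auto simp: neq_Nil_conv)
    then show ?thesis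
      using IH True by (intro exI[of _ "[]"] exI[of _ "a # c"] exI[of _ "tl y"]) simp
  next
    case False
    then have "push a (x @ y) = a # x @ y"
      using Cons.prems IH by (cases x; cases y) (auto simp: reduced_Cons)
    then show ?thesis using IH by (intro exI[of _ "a # x"] exI[of _ c] exI[of _ y]) simp
  qed
qed

lemma joint_tripod_bound: "\<bar>joint x c + joint (inv_word c) y - joint x y\<bar> \<le> 1"
proof -
  have "inv_letter (last (inv_word c)) = hd c" if "c \<noteq> []"
    using that by (cases c) auto
  then show ?thesis
    by (cases "c = []") (auto simp: joint_def turn_bound turn_cocycle_bound)
qed

lemma path_weight_foldr_push:
  assumes "reduced v"
  shows "\<bar>path_weight v + path_weight w - path_weight (foldr push v w)\<bar> \<le> 1"
proof -
  obtain x c y where split: "v = x @ c" "w = inv_word c @ y" "foldr push v w = x @ y"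
    using foldr_push_cancellation[OF assms] by blast
  have "path_weight v + path_weight w - path_weight (foldr push v w)
      = joint x c + joint (inv_word c) y - joint x y"
    unfolding split(3) by (simp add: split(1,2) path_weight_append path_weight_inv_word)
  then show ?thesis using joint_tripod_bound by simp
qed

theorem positive_cone_free_group:
  "positive_cone (free_group k) {w \<in> carrier (free_group k). path_weight w > 0}"
proof -
  let ?F = "free_group k"
  interpret F: group ?F by (rule group_free_group)
  have one: "\<one>\<^bsub>?F\<^esub> = []" and reduced: "w \<in> carrier ?F \<Longrightarrow> reduced w" for w
    by (simp_all add: free_group_def)
  have mult: "\<bar>path_weight v + path_weight w - path_weight (v \<otimes>\<^bsub>?F\<^esub> w)\<bar> \<le> 1"
    if "v \<in> carrier ?F" for v w
    using path_weight_foldr_push[OF reduced[OF that]] by (simp add: free_group_def)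
  have "path_weight (v \<otimes>\<^bsub>?F\<^esub> w) > 0"
    if "v \<in> carrier ?F" "path_weight v > 0" "path_weight w > 0" for v w
    using mult[OF that(1), of w] that(2,3) by linarith
  moreover have "path_weight w > 0 \<or> path_weight (inv\<^bsub>?F\<^esub> w) > 0"
    if w: "w \<in> carrier ?F" "w \<noteq> []" for w
  proof -
    have "inv\<^bsub>?F\<^esub> w \<in> carrier ?F" "inv\<^bsub>?F\<^esub> w \<noteq> []" using w F.inv_eq_1_iff one by auto
    then have "odd (path_weight w)" "odd (path_weight (inv\<^bsub>?F\<^esub> w))"
      using odd_path_weight reduced w by auto
    moreover have "\<bar>path_weight w + path_weight (inv\<^bsub>?F\<^esub> w)\<bar> \<le> 1"
      using mult[OF w(1), of "inv\<^bsub>?F\<^esub> w"] w(1) one by simp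
    ultimately show ?thesis by presburger
  qed
  ultimately show ?thesis by (auto simp: positive_cone_def decides_signs_def one)
qed

section \<open>The lattice-ordered group of automorphisms of a chain\<close>

definition order_auto :: "'a set \<Rightarrow> 'a rel \<Rightarrow> ('a \<Rightarrow> 'a) set" where
  "order_auto C r = {f \<in> Bij C. \<forall>x\<in>C. \<forall>y\<in>C. (f x, f y) \<in> r \<longleftrightarrow> (x, y) \<in> r}"

definition pointwise_min :: "'a set \<Rightarrow> 'b rel \<Rightarrow> ('a \<Rightarrow> 'b) \<Rightarrow> ('a \<Rightarrow> 'b) \<Rightarrow> 'a \<Rightarrow> 'b" where
  "pointwise_min C r f g = (\<lambda>x\<in>C. if (f x, g x) \<in> r then f x else g x)"

definition order_auto_lgroup :: "'a set \<Rightarrow> 'a rel \<Rightarrow> ('a \<Rightarrow> 'a) lgroup" where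
  "order_auto_lgroup C r =
     \<lparr>carrier = order_auto C r, mult = compose C, one = (\<lambda>x\<in>C. x),
      lmeet = pointwise_min C r, ljoin = pointwise_min C (r\<inverse>)\<rparr>"

lemma order_autoD:
  assumes "f \<in> order_auto C r"
  shows "f \<in> extensional C" and "f ` C = C" and "x \<in> C \<Longrightarrow> f x \<in> C"
    and "x \<in> C \<Longrightarrow> y \<in> C \<Longrightarrow> (f x, f y) \<in> r \<longleftrightarrow> (x, y) \<in> r"
  using assms by (auto simp: order_auto_def Bij_def bij_betw_def)

lemma order_autoI:
  assumes r: "linear_order_on C r" and f: "f \<in> extensional C" "f ` C = C"
    and order: "\<And>x y. x \<in> C \<Longrightarrow> y \<in> C \<Longrightarrow> (f x, f y) \<in> r \<longleftrightarrow> (x, y) \<in> r"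
  shows "f \<in> order_auto C r"
proof -
  have "inj_on f C"
  proof (rule inj_onI)
    fix x y assume "x \<in> C" "y \<in> C" "f x = f y"
    then show "x = y"
      using r order[of x x] order[of x y] order[of y x]
      by (auto simp: order_on_defs refl_on_def dest: antisymD)
  qed
  then show ?thesis using f order by (auto simp: order_auto_def Bij_def bij_betw_def)
qed

lemma order_auto_converse: "order_auto C (r\<inverse>) = order_auto C r"
  by (auto simp: order_auto_def)

lemma group_order_auto_lgroup: "group (order_auto_lgroup C r)"
proof (rule groupI)
  fix f assume "f \<in> carrier (order_auto_lgroup C r)"
  then have f: "f \<in> order_auto C r" by (simp add: order_auto_lgroup_def)
  let ?g = "restrict (inv_into C f) C"
  have "f \<in> Bij C" using f by (simp add: order_auto_def)
  have "f (inv_into C f x) = x" "inv_into C f x \<in> C" if "x \<in> C" for x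
    using that order_autoD(2)[OF f] by (simp_all add: f_inv_into_f inv_into_into)
  then have "(?g x, ?g y) \<in> r \<longleftrightarrow> (x, y) \<in> r" if "x \<in> C" "y \<in> C" for x y
    using that order_autoD(4)[OF f, of "?g x" "?g y"] by simp
  then have "?g \<in> order_auto C r"
    using restrict_inv_into_Bij[OF \<open>f \<in> Bij C\<close>] by (simp add: order_auto_def)
  then show "\<exists>g\<in>carrier (order_auto_lgroup C r).
      g \<otimes>\<^bsub>order_auto_lgroup C r\<^esub> f = \<one>\<^bsub>order_auto_lgroup C r\<^esub>"
    using Bij_compose_restrict_eq[OF \<open>f \<in> Bij C\<close>] by (auto simp: order_auto_lgroup_def)
qed (auto simp: order_auto_lgroup_def order_auto_def compose_Bij id_Bij compose_assoc[symmetric]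
  Bij_imp_extensional Bij_imp_funcset compose_eq funcset_mem[OF Bij_imp_funcset])

context
  fixes D :: "'b set" and r :: "'b rel"
  assumes r: "linear_order_on D r"
begin

lemma linear_order_on_cases:
  assumes "x \<in> D" "y \<in> D"
  shows "(x, y) \<in> r \<or> (y, x) \<in> r"
  using r assms by (cases "x = y") (auto simp: order_on_defs total_on_def refl_on_def)

lemma linear_order_on_trans: "(x, y) \<in> r \<Longrightarrow> (y, z) \<in> r \<Longrightarrow> (x, z) \<in> r"
  using r by (auto simp: order_on_defs dest: transD)

lemma linear_order_on_antisym: "(x, y) \<in> r \<Longrightarrow> (y, x) \<in> r \<Longrightarrow> x = y"
  using r by (auto simp: order_on_defs dest: antisymD)

lemma pointwise_min_le:
  assumes "f x \<in> D" "g x \<in> D" "x \<in> C"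
  shows "(pointwise_min C r f g x, f x) \<in> r" "(pointwise_min C r f g x, g x) \<in> r"
  using assms linear_order_on_cases[of "f x" "g x"] linear_order_on_cases[of "f x" "f x"]
    linear_order_on_cases[of "g x" "g x"]
  by (auto simp: pointwise_min_def)

lemma le_pointwise_min_iff:
  assumes "f x \<in> D" "g x \<in> D" "x \<in> C"
  shows "(y, pointwise_min C r f g x) \<in> r \<longleftrightarrow> (y, f x) \<in> r \<and> (y, g x) \<in> r"
proof
  assume "(y, pointwise_min C r f g x) \<in> r"
  from linear_order_on_trans[OF this] show "(y, f x) \<in> r \<and> (y, g x) \<in> r"
    using pointwise_min_le[of f x g C] assms by blast
qed (use assms in \<open>simp add: pointwise_min_def\<close>)

lemma pointwise_min_commute:
  assumes "f \<in> C \<rightarrow> D" "g \<in> C \<rightarrow> D"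
  shows "pointwise_min C r f g = pointwise_min C r g f"
proof
  fix x
  show "pointwise_min C r f g x = pointwise_min C r g f x"
    using assms linear_order_on_cases[of "f x" "g x"] linear_order_on_antisym[of "f x" "g x"]
    by (auto simp: pointwise_min_def restrict_def)
qed

lemma pointwise_min_assoc:
  assumes "f \<in> C \<rightarrow> D" "g \<in> C \<rightarrow> D" "h \<in> C \<rightarrow> D"
  shows "pointwise_min C r (pointwise_min C r f g) h = pointwise_min C r f (pointwise_min C r g h)"
proof
  fix x
  show "pointwise_min C r (pointwise_min C r f g) h x =
      pointwise_min C r f (pointwise_min C r g h) x"
  proof (cases "x \<in> C")
    case True
    then have "f x \<in> D" "g x \<in> D" "h x \<in> D" using assms by auto
    then show ?thesis
      using True linear_order_on_cases[of "f x" "g x"] linear_order_on_cases[of "g x" "h x"]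
        linear_order_on_trans[of "f x" "g x" "h x"] linear_order_on_trans[of "h x" "g x" "f x"]
        linear_order_on_antisym[of "f x" "h x"]
      by (auto simp: pointwise_min_def)
  qed (simp add: pointwise_min_def)
qed

lemma pointwise_min_absorb:
  assumes "f \<in> C \<rightarrow> D" "g \<in> C \<rightarrow> D" "f \<in> extensional C"
  shows "pointwise_min C r f (pointwise_min C (r\<inverse>) f g) = f"
proof
  fix x
  show "pointwise_min C r f (pointwise_min C (r\<inverse>) f g) x = f x"
    using assms linear_order_on_cases[of "f x" "f x"] linear_order_on_cases[of "f x" "g x"]
    by (cases "x \<in> C") (auto simp: pointwise_min_def extensional_def)
qed

lemma pointwise_min_eq_left_iff:
  assumes "f \<in> C \<rightarrow> D" "f \<in> extensional C"
  shows "pointwise_min C r f g = f \<longleftrightarrow> (\<forall>x\<in>C. (f x, g x) \<in> r)"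
proof
  assume eq: "pointwise_min C r f g = f"
  show "\<forall>x\<in>C. (f x, g x) \<in> r"
  proof
    fix x assume "x \<in> C"
    then show "(f x, g x) \<in> r"
      using fun_cong[OF eq, of x] assms(1) linear_order_on_cases[of "f x" "f x"]
      by (auto simp: pointwise_min_def split: if_splits)
  qed
next
  assume "\<forall>x\<in>C. (f x, g x) \<in> r"
  then show "pointwise_min C r f g = f"
    using assms(2) by (auto simp: pointwise_min_def fun_eq_iff extensional_def)
qed

end

lemma image_pointwise_min:
  assumes r: "linear_order_on C r" and f: "f \<in> order_auto C r" and g: "g \<in> order_auto C r"
  shows "pointwise_min C r f g ` C = C" (is "?m ` C = C")
proof
  show "?m ` C \<subseteq> C"
    using order_autoD(3)[OF f] order_autoD(3)[OF g] by (auto simp: pointwise_min_def)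
  show "C \<subseteq> ?m ` C"
  proof
    fix y assume y: "y \<in> C"
    obtain u v where u: "u \<in> C" "f u = y" and v: "v \<in> C" "g v = y"
      using y order_autoD(2)[OF f] order_autoD(2)[OF g] by (metis imageE)
    consider "(u, v) \<in> r" | "(v, u) \<in> r" using linear_order_on_cases[OF r u(1) v(1)] by blast
    then show "y \<in> ?m ` C"
    proof cases
      case 1
      then have "(y, f v) \<in> r" using order_autoD(4)[OF f u(1) v(1)] u(2) by simp
      then have "?m v = y"
        using v linear_order_on_antisym[OF r] by (auto simp: pointwise_min_def)
      then show ?thesis using v(1) by blast
    next
      case 2
      then have "(y, g u) \<in> r" using order_autoD(4)[OF g v(1) u(1)] v(2) by simp
      then have "?m u = y" using u by (simp add: pointwise_min_def)
      then show ?thesis using u(1) by blast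
    qed
  qed
qed

lemma pointwise_min_order_auto:
  assumes r: "linear_order_on C r" and f: "f \<in> order_auto C r" and g: "g \<in> order_auto C r"
  shows "pointwise_min C r f g \<in> order_auto C r" (is "?m \<in> _")
proof (rule order_autoI[OF r])
  note fg = order_autoD(3)[OF f] order_autoD(3)[OF g]
  show "?m \<in> extensional C" by (simp add: pointwise_min_def)
  show "?m ` C = C" using assms by (rule image_pointwise_min)
  show "(?m x, ?m y) \<in> r \<longleftrightarrow> (x, y) \<in> r" if xy: "x \<in> C" "y \<in> C" for x y
  proof
    assume "(?m x, ?m y) \<in> r"
    then have "(?m x, f y) \<in> r" "(?m x, g y) \<in> r"
      using xy fg by (simp_all add: le_pointwise_min_iff[OF r])
    then have "(f x, f y) \<in> r \<or> (g x, g y) \<in> r"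
      using xy by (auto simp: pointwise_min_def split: if_splits)
    then show "(x, y) \<in> r" using xy order_autoD(4)[OF f] order_autoD(4)[OF g] by blast
  next
    assume "(x, y) \<in> r"
    then have mono: "(f x, f y) \<in> r" "(g x, g y) \<in> r"
      using xy order_autoD(4)[OF f] order_autoD(4)[OF g] by blast+
    have lower: "(?m x, f x) \<in> r" "(?m x, g x) \<in> r"
      using xy fg pointwise_min_le[OF r, of f x g C] by simp_all
    show "(?m x, ?m y) \<in> r"
      using xy fg linear_order_on_trans[OF r lower(1) mono(1)]
        linear_order_on_trans[OF r lower(2) mono(2)]
      by (simp add: le_pointwise_min_iff[OF r])
  qed
qed

lemma lg_le_order_auto_lgroup_iff:
  assumes "linear_order_on C r" "f \<in> C \<rightarrow> C" "f \<in> extensional C"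
  shows "lg_le (order_auto_lgroup C r) f g \<longleftrightarrow> (\<forall>x\<in>C. (f x, g x) \<in> r)"
  using pointwise_min_eq_left_iff[OF assms] by (simp add: lg_le_def order_auto_lgroup_def)

lemma lg_le_order_auto_lgroup_compose:
  assumes r: "linear_order_on C r"
    and auto: "a \<in> order_auto C r" "b \<in> order_auto C r" "c \<in> order_auto C r" "d \<in> order_auto C r"
    and le: "lg_le (order_auto_lgroup C r) a b"
  shows "lg_le (order_auto_lgroup C r) (compose C (compose C c a) d) (compose C (compose C c b) d)"
proof -
  note closed = auto[THEN order_autoD(3)]
  have ab: "\<forall>x\<in>C. (a x, b x) \<in> r"
    using le lg_le_order_auto_lgroup_iff[OF r] closed(1) order_autoD(1)[OF auto(1)] by blast
  have "(c (a (d x)), c (b (d x))) \<in> r" if "x \<in> C" for x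
    using ab closed that by (simp add: order_autoD(4)[OF auto(3)])
  then show ?thesis
    using closed by (subst lg_le_order_auto_lgroup_iff[OF r]) (auto simp: compose_def)
qed

theorem l_group_order_auto_lgroup:
  assumes r: "linear_order_on C r"
  shows "l_group (order_auto_lgroup C r)"
proof (intro l_group.intro group_order_auto_lgroup l_group_axioms.intro)
  let ?L = "order_auto_lgroup C r"
  have converse: "linear_order_on C (r\<inverse>)" using r by simp
  have carrier: "carrier ?L = order_auto C r" and meet: "lmeet ?L = pointwise_min C r"
    and join: "ljoin ?L = pointwise_min C (r\<inverse>)" and mult: "mult ?L = compose C"
    by (simp_all add: order_auto_lgroup_def)
  have ext: "f \<in> extensional C" and map: "f \<in> C \<rightarrow> C" if "f \<in> carrier ?L" for f
    using order_autoD[of f C r] that by (auto simp: carrier)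
  fix f g assume fg: "f \<in> carrier ?L" "g \<in> carrier ?L"
  show "lmeet ?L f g \<in> carrier ?L"
    using fg pointwise_min_order_auto[OF r] by (simp add: carrier meet)
  show "ljoin ?L f g \<in> carrier ?L"
    using fg pointwise_min_order_auto[OF converse] by (simp add: carrier join order_auto_converse)
  show "lmeet ?L f g = lmeet ?L g f"
    using fg[THEN map] unfolding meet by (rule pointwise_min_commute[OF r])
  show "ljoin ?L f g = ljoin ?L g f"
    using fg[THEN map] unfolding join by (rule pointwise_min_commute[OF converse])
  show "lmeet ?L f (ljoin ?L f g) = f"
    using fg[THEN map] ext[OF fg(1)] unfolding meet join by (rule pointwise_min_absorb[OF r])
  show "ljoin ?L f (lmeet ?L f g) = f"
    using fg[THEN map] ext[OF fg(1)] pointwise_min_absorb[OF converse, of f C g]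
    by (simp add: meet join)
  fix h assume h: "h \<in> carrier ?L"
  show "lmeet ?L (lmeet ?L f g) h = lmeet ?L f (lmeet ?L g h)"
    using fg[THEN map] map[OF h] unfolding meet by (rule pointwise_min_assoc[OF r])
  show "ljoin ?L (ljoin ?L f g) h = ljoin ?L f (ljoin ?L g h)"
    using fg[THEN map] map[OF h] unfolding join by (rule pointwise_min_assoc[OF converse])
  fix d assume "d \<in> carrier ?L" "lg_le ?L f g"
  then show "lg_le ?L (h \<otimes>\<^bsub>?L\<^esub> f \<otimes>\<^bsub>?L\<^esub> d) (h \<otimes>\<^bsub>?L\<^esub> g \<otimes>\<^bsub>?L\<^esub> d)"
    using fg h lg_le_order_auto_lgroup_compose[OF r] by (simp add: carrier mult)
qed

lemma lg_Join_order_auto_lgroup: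
  "fs \<noteq> [] \<Longrightarrow> x \<in> C \<Longrightarrow> \<exists>f\<in>set fs. lg_Join (order_auto_lgroup C r) fs x = f x"
  by (induction fs rule: induct_list012) (auto simp: order_auto_lgroup_def pointwise_min_def)

text \<open>The inverse makes up for the contravariance of right translations.\<close>

definition inv_right_translation :: "('a, 'm) monoid_scheme \<Rightarrow> 'a \<Rightarrow> 'a \<Rightarrow> 'a" where
  "inv_right_translation G g = (\<lambda>x\<in>carrier G. x \<otimes>\<^bsub>G\<^esub> inv\<^bsub>G\<^esub> g)"

context group
begin

lemma inv_right_translation_order_auto:
  assumes r: "right_order G r" and g: "g \<in> carrier G"
  shows "inv_right_translation G g \<in> order_auto (carrier G) r"
proof (rule order_autoI[OF right_order_linear_order_on[OF r]])
  show "inv_right_translation G g \<in> extensional (carrier G)" by (simp add: inv_right_translation_def)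
  have "x = inv_right_translation G g (x \<otimes> g)" if "x \<in> carrier G" for x
    using that g by (simp add: inv_right_translation_def m_assoc)
  then show "inv_right_translation G g ` carrier G = carrier G"
    using g by (auto simp: inv_right_translation_def)
  fix x y assume xy: "x \<in> carrier G" "y \<in> carrier G"
  have "(x, y) \<in> r" if "(x \<otimes> inv g, y \<otimes> inv g) \<in> r"
    using right_order_mult_right[OF r that g] xy g by (simp add: m_assoc)
  then show "(inv_right_translation G g x, inv_right_translation G g y) \<in> r \<longleftrightarrow> (x, y) \<in> r"
    using xy g right_order_mult_right[OF r] by (auto simp: inv_right_translation_def)
qed

lemma inv_right_translation_hom:
  assumes "right_order G r"
  shows "inv_right_translation G \<in> hom G (order_auto_lgroup (carrier G) r)"
proof (rule homI)
  fix g h assume gh: "g \<in> carrier G" "h \<in> carrier G"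
  show "inv_right_translation G g \<in> carrier (order_auto_lgroup (carrier G) r)"
    using inv_right_translation_order_auto[OF assms gh(1)] by (simp add: order_auto_lgroup_def)
  show "inv_right_translation G (g \<otimes> h) =
      inv_right_translation G g \<otimes>\<^bsub>order_auto_lgroup (carrier G) r\<^esub> inv_right_translation G h"
    using gh by (auto simp: inv_right_translation_def order_auto_lgroup_def compose_def fun_eq_iff
        inv_mult_group m_assoc)
qed

theorem not_one_le_lg_Join_inv_right_translation:
  assumes r: "right_order G r" and us: "us \<noteq> []" "\<And>u. u \<in> set us \<Longrightarrow> strict r \<one> u"
  defines "L \<equiv> order_auto_lgroup (carrier G) r"
  shows "\<not> lg_le L \<one>\<^bsub>L\<^esub> (lg_Join L (map (inv_right_translation G) us))"
proof
  let ?J = "lg_Join L (map (inv_right_translation G) us)"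
  note linear = right_order_linear_order_on[OF r]
  assume "lg_le L \<one>\<^bsub>L\<^esub> ?J"
  then have "(\<one>, ?J \<one>) \<in> r"
    using lg_le_order_auto_lgroup_iff[OF linear, of "\<one>\<^bsub>L\<^esub>" ?J]
    by (auto simp: L_def order_auto_lgroup_def)
  moreover obtain u where u: "u \<in> set us" "?J \<one> = inv_right_translation G u \<one>"
    using lg_Join_order_auto_lgroup[of "map (inv_right_translation G) us" \<one> "carrier G" r] us(1)
    by (auto simp: L_def)
  moreover have u_pos: "u \<in> carrier G" "(\<one>, u) \<in> r" "u \<noteq> \<one>"
    using us(2)[OF u(1)] partial_order_onD(4)[OF right_order_partial_order_on[OF r]]
    by (auto simp: strict_def)
  ultimately have "(\<one>, inv u) \<in> r" by (simp add: inv_right_translation_def)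
  from right_order_mult_right[OF r this u_pos(1)] have "(u, \<one>) \<in> r" using u_pos(1) by simp
  then show False using u_pos linear_order_on_antisym[OF linear] by blast
qed

end

section \<open>Validity through the free group\<close>

lemma geval_cong: "(\<And>i. i \<in> gvars t \<Longrightarrow> \<phi> i = \<psi> i) \<Longrightarrow> geval G \<phi> t = geval G \<psi> t"
  by (induction t) auto

lemma (in group) geval_closed: "\<phi> \<in> gvars t \<rightarrow> carrier G \<Longrightarrow> geval G \<phi> t \<in> carrier G"
  by (induction t) auto

lemma (in group_hom) geval_hom:
  "\<phi> \<in> gvars t \<rightarrow> carrier G \<Longrightarrow> geval H (h \<circ> \<phi>) t = h (geval G \<phi> t)"
  by (induction t) (auto simp: G.geval_closed)

lemma free_image_closed:
  "gvars t \<subseteq> {..<k} \<Longrightarrow> free_image k t \<in> carrier (free_group k)"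
  unfolding free_image_def
  by (rule group.geval_closed[OF group_free_group]) (auto simp: free_gen_closed)

lemma geval_free_image:
  assumes "h \<in> hom (free_group k) H" "group H" "gvars t \<subseteq> {..<k}"
  shows "geval H (h \<circ> free_gen) t = h (free_image k t)"
proof -
  interpret group_hom "free_group k" H h
    using assms by (simp add: group_hom_def group_hom_axioms_def group_free_group)
  show ?thesis
    unfolding free_image_def using assms(3) by (intro geval_hom) (auto simp: free_gen_closed)
qed

theorem LG_models_iff_hom:
  assumes vars: "\<forall>t\<in>set ts. gvars t \<subseteq> {..<k}"
  shows "LG_models TYPE('a) k ts \<longleftrightarrow>
    (\<forall>L :: 'a lgroup. l_group L \<longrightarrow> (\<forall>h \<in> hom (free_group k) L.
       lg_le L \<one>\<^bsub>L\<^esub> (lg_Join L (map h (map (free_image k) ts)))))"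
    (is "_ \<longleftrightarrow> ?hom_valid")
proof
  have eval: "map (geval L (h \<circ> free_gen)) ts = map h (map (free_image k) ts)"
    if "l_group L" "h \<in> hom (free_group k) L" for L :: "'a lgroup" and h
    using that vars by (simp add: geval_free_image l_group.axioms(1))
  show ?hom_valid if valid: "LG_models TYPE('a) k ts"
  proof (intro allI impI ballI)
    fix L :: "'a lgroup" and h assume L: "l_group L" and h: "h \<in> hom (free_group k) L"
    have "h \<circ> free_gen \<in> {..<k} \<rightarrow> carrier L" using hom_in_carrier[OF h] free_gen_closed by auto
    then show "lg_le L \<one>\<^bsub>L\<^esub> (lg_Join L (map h (map (free_image k) ts)))"
      using valid L unfolding eval[OF L h, symmetric] by (simp add: LG_models_def)
  qed
  show "LG_models TYPE('a) k ts" if valid: ?hom_valid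
    unfolding LG_models_def
  proof (intro allI impI ballI)
    fix L :: "'a lgroup" and \<phi> assume L: "l_group L" and \<phi>: "\<phi> \<in> {..<k} \<rightarrow> carrier L"
    obtain h where h: "h \<in> hom (free_group k) L" "\<forall>i<k. h (free_gen i) = \<phi> i"
      using free_group_universal[OF l_group.axioms(1)[OF L] \<phi>] by blast
    have "geval L \<phi> t = geval L (h \<circ> free_gen) t" if "gvars t \<subseteq> {..<k}" for t
      using that h(2) by (intro geval_cong) auto
    with vars have eq: "map (geval L \<phi>) ts = map (geval L (h \<circ> free_gen)) ts" by simp
    show "lg_le L \<one>\<^bsub>L\<^esub> (lg_Join L (map (geval L \<phi>) ts))"
      using valid L h(1) unfolding eq eval[OF L h(1)] by blast
  qed
qed

theorem LG_models_iff_not_extends_to_right_order: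
  assumes ts: "ts \<noteq> []" "\<forall>t\<in>set ts. gvars t \<subseteq> {..<k}"
  shows "LG_models TYPE('a::infinite) k ts \<longleftrightarrow>
    \<not> extends_to_right_order (free_group k) (free_image k ` set ts)"
proof
  let ?us = "map (free_image k) ts"
  interpret F: group "free_group k" by (rule group_free_group)
  assume "LG_models TYPE('a) k ts"
  then have valid: "LG_models TYPE(letter list \<Rightarrow> letter list) k ts"
    using ts by (rule LG_models_any_type)
  show "\<not> extends_to_right_order (free_group k) (free_image k ` set ts)"
  proof
    assume "extends_to_right_order (free_group k) (free_image k ` set ts)"
    then obtain r where r: "right_order (free_group k) r"
      and pos: "\<forall>u\<in>set ?us. strict r \<one>\<^bsub>free_group k\<^esub> u"
      by (auto simp: extends_to_right_order_def)
    let ?L = "order_auto_lgroup (carrier (free_group k)) r"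
    have "l_group ?L"
      using l_group_order_auto_lgroup F.right_order_linear_order_on[OF r] .
    then show False
      using valid[unfolded LG_models_iff_hom[OF ts(2)]] F.inv_right_translation_hom[OF r]
        F.not_one_le_lg_Join_inv_right_translation[OF r, of ?us] ts(1) pos by blast
  qed
next
  interpret F: group "free_group k" by (rule group_free_group)
  assume "\<not> extends_to_right_order (free_group k) (free_image k ` set ts)"
  then show "LG_models TYPE('a) k ts"
    unfolding LG_models_iff_hom[OF ts(2)]
    using F.extends_to_right_order_if_not_one_le_lg_Join[OF _ _ positive_cone_free_group,
        where us = "map (free_image k) ts"] ts free_image_closed
    by fastforce
qed

theorem theorem4:
  fixes k :: nat and ts :: "gterm list"
  assumes "ts \<noteq> []" and "\<forall>t \<in> set ts. gvars t \<subseteq> {..<k}"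
  shows
    "(LG_models TYPE('a::infinite) k ts \<longleftrightarrow>
        \<not> extends_to_right_order (free_group k) (free_image k ` set ts))
     \<and>
     (\<not> extends_to_right_order (free_group k) (free_image k ` set ts) \<longleftrightarrow>
        (\<exists>(m::nat) s. (\<forall>i<m. s i \<in> carrier (free_group k) - {\<one>\<^bsub>free_group k\<^esub>}) \<and>
           (\<forall>\<delta> :: nat \<Rightarrow> int. (\<forall>i<m. \<delta> i \<in> {-1, 1}) \<longrightarrow>
              \<one>\<^bsub>free_group k\<^esub> \<in> subsemigroup (free_group k)
                (free_image k ` set ts \<union> {s i [^]\<^bsub>free_group k\<^esub> \<delta> i | i. i < m}))))"
proof -
  have "free_image k ` set ts \<subseteq> carrier (free_group k)"
    using assms(2) free_image_closed by blast
  then have "\<not> extends_to_right_order (free_group k) (free_image k ` set ts) \<longleftrightarrow>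
      sign_refutable (free_group k) (free_image k ` set ts)"
    by (simp add: group.extends_to_right_order_iff_not_sign_refutable[OF group_free_group])
  with LG_models_iff_not_extends_to_right_order[OF assms] show ?thesis
    unfolding sign_refutable_def by (rule conjI)
qed

end
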